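(* Let $\gamma>0$. The $M$-stationary waves of $i\partial_tu=\Pi(|u|^2u)$ in $\mathcal G$ are given by the formula $$u(t,z)=\kappa\,\psi_k(z)\exp\Big(-i\frac{|\kappa|^2t}{\gamma\sqrt\pi}\Big),\qquad k\in\mathbb Z,\ \kappa\in\mathbb C;$$ that is, each such function is an $M$-stationary wave, and every $M$-stationary wave with initial profile $u_0\in\mathcal G$ is of this form. There are no $MQ$-stationary waves with $u_0\in\mathcal G$ beyond these examples.
   Context: $L$ is Lebesgue measure on $\mathbb C$. For a function $u$ on $\mathbb C$ of at most polynomial growth, $[\Pi u](z)=\frac1\pi e^{-|z|^2/2}\int_{\mathbb C}e^{\overline w z-|w|^2/2}u(w)\,dL(w)$. $\widetilde{\mathcal E}$ is the set of functions $u(z)=e^{-|z|^2/2}f(z)$ with $f$ entire such that $|u(z)|\lesssim\langle z\rangle^M$ for some $M$; $R_\alpha u(z)=e^{(\alpha\overline z-\overline\alpha z)/2}u(z+\alpha)$ for $\alpha\in\mathbb C$; $\mathcal F_\gamma=\{u\in\widetilde{\mathcal E}:R_\gamma u=u\}$. $$\mathcal G=\{u\in\mathcal F_\gamma:\ u\text{ has a finite number of zeros modulo }\gamma\}.$$ $$\psi_k(z)=\Big(\frac2{\pi\gamma^2}\Big)^{1/4}\exp\Big(-\frac{\pi^2k^2}{\gamma^2}+\frac{2ik\pi}\gamma z+\frac{z^2}2-\frac{|z|^2}2\Big),\quad k\in\mathbb Z.$$ An $M$-stationary wave is a solution of $i\partial_tu=\Pi(|u|^2u)$ of the form $u(t)=e^{-iat}u_0$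 with $a\in\mathbb R$, $u_0\in\mathcal F_\gamma$. An $MQ$-stationary wave is a solution of the form $u(t)=e^{-iat}R_{-\alpha t}u_0$ with $a\in\mathbb R$, $\alpha\in\mathbb C$, $u_0\in\mathcal F_\gamma$. *)

theory Defs
  imports "HOL-Complex_Analysis.Complex_Analysis"
begin

(* Meaningful for measurable u of at most polynomial growth: the integrand is then
   Lebesgue integrable for every z. *)
definition LLL_proj :: "(complex \<Rightarrow> complex) \<Rightarrow> complex \<Rightarrow> complex" where
  "LLL_proj u z =
     1 / of_real pi * exp (- of_real ((cmod z)\<^sup>2) / 2) *
     (LINT w|lborel. exp (cnj w * z - of_real ((cmod w)\<^sup>2) / 2) * u w)"

definition japanese_bracket :: "complex \<Rightarrow> real" where
  "japanese_bracket z = sqrt (1 + (cmod z)\<^sup>2)"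

definition LLL_space :: "(complex \<Rightarrow> complex) set" where
  "LLL_space = {u.
     (\<exists>f. f holomorphic_on UNIV \<and>
          (\<forall>z. u z = exp (- of_real ((cmod z)\<^sup>2) / 2) * f z)) \<and>
     (\<exists>(M::real) (C::real). \<forall>z. cmod (u z) \<le> C * japanese_bracket z powr M)}"

definition magnetic_translation ::
    "complex \<Rightarrow> (complex \<Rightarrow> complex) \<Rightarrow> complex \<Rightarrow> complex" where
  "magnetic_translation \<alpha> u z = exp ((\<alpha> * cnj z - cnj \<alpha> * z) / 2) * u (z + \<alpha>)"

definition F_space :: "real \<Rightarrow> (complex \<Rightarrow> complex) set" where
  "F_space \<gamma> = {u \<in> LLL_space. magnetic_translation (of_real \<gamma>) u = u}"

definition period_rel :: "real \<Rightarrow> (complex \<times> complex) set" where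
  "period_rel \<gamma> = {(z, w). \<exists>n::int. w = z + of_int n * of_real \<gamma>}"

(* The zeros are counted as classes modulo the lattice of integer multiples of \<gamma>,
   without multiplicity. The zero function is not a member. *)
definition G_space :: "real \<Rightarrow> (complex \<Rightarrow> complex) set" where
  "G_space \<gamma> = {u \<in> F_space \<gamma>. finite ({z. u z = 0} // period_rel \<gamma>)}"

definition psi :: "real \<Rightarrow> int \<Rightarrow> complex \<Rightarrow> complex" where
  "psi \<gamma> k z =
     of_real ((2 / (pi * \<gamma>\<^sup>2)) powr (1/4)) *
     exp (- (of_real pi)\<^sup>2 * (of_int k)\<^sup>2 / (of_real \<gamma>)\<^sup>2
          + 2 * \<i> * of_int k * of_real pi / of_real \<gamma> * z
          + z\<^sup>2 / 2 - of_real ((cmod z)\<^sup>2) / 2)"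

(* The time derivative is taken pointwise in z. *)
definition LLL_solution :: "(real \<Rightarrow> complex \<Rightarrow> complex) \<Rightarrow> bool" where
  "LLL_solution u \<longleftrightarrow>
     (\<forall>t z. \<exists>D. ((\<lambda>s. u s z) has_vector_derivative D) (at t) \<and>
            \<i> * D = LLL_proj (\<lambda>w. of_real ((cmod (u t w))\<^sup>2) * u t w) z)"

definition M_stationary_wave :: "real \<Rightarrow> (real \<Rightarrow> complex \<Rightarrow> complex) \<Rightarrow> bool" where
  "M_stationary_wave \<gamma> u \<longleftrightarrow>
     LLL_solution u \<and>
     (\<exists>(a::real). \<exists>u0\<in>F_space \<gamma>. \<forall>t z. u t z = exp (- \<i> * of_real (a * t)) * u0 z)"

definition MQ_stationary_wave :: "real \<Rightarrow> (real \<Rightarrow> complex \<Rightarrow> complex) \<Rightarrow> bool" where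
  "MQ_stationary_wave \<gamma> u \<longleftrightarrow>
     LLL_solution u \<and>
     (\<exists>(a::real) (\<alpha>::complex). \<exists>u0\<in>F_space \<gamma>. \<forall>t z.
        u t z = exp (- \<i> * of_real (a * t)) *
                magnetic_translation (- \<alpha> * of_real t) u0 z)"

end

(*
  Write u = exp(z^2/2 - |z|^2/2) g. Membership in F_gamma means that the entire function g is
  gamma-periodic and of Gaussian growth, so g(z) = h(exp(2 pi i z/gamma)) with h holomorphic on the
  punctured plane. If h has finitely many zeros, dividing them out leaves exp(G) with Re G = O(|z|^2);
  by Borel-Caratheodory and Liouville G is a quadratic polynomial, and periodicity makes it linear.
  Hence u is a finite combination of the psi_n.

  A Gaussian integral gives Pi(psi_k conj(psi_l) psi_m) as a positive multiple of psi_(k-l+m).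
  If the extreme frequencies n_0 < n_1 of u were distinct, the frequency 2 n_1 - n_0 > n_1 would
  occur in Pi(|u|^2 u) but not in the linear side of the profile equation. For travelling profiles the
  linear side contains the term (conj(alpha) - alpha) z, which is not periodic, so alpha is real, and a
  real translation acts on psi_k by a phase.
*)

theory Submission
  imports Defs "HOL-Probability.Characteristic_Functions"
begin

section \<open>Gaussian integrals over the plane\<close>

text \<open>On the punctured plane the zero-free factor may wind around 0 and so have no logarithm.
  The logarithm is therefore taken on the whole plane, after composition with the exponential map,
  and the winding survives as the integer by which all frequencies are shifted.

  The Gaussian bound on g passes to the zero-free factor directly only where the divisor polynomial
  is bounded away from 0. The remaining points exp(2 pi i z/gamma) lie in a compact annulus of the
  punctured plane, and there the factor is bounded by continuity.

  Frequencies are compared along the imaginary axis, where exp(2 pi i n z/gamma) becomes a real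
  exponential: a frequency that exceeds all others and occurs once dominates the sum, so its
  coefficient can be read off in a limit.\<close>

lemma complex_std_gaussian:
  "has_bochner_integral lborel (\<lambda>x::real. exp (- of_real (x\<^sup>2) / 2 + \<i> * of_real (t * x)))
     (complex_of_real (sqrt (2 * pi) * exp (- (t\<^sup>2) / 2)))"
proof -
  interpret real_distribution std_normal_distribution
    by (rule real_dist_normal_dist)
  let ?d = "\<lambda>x. std_normal_density x *\<^sub>R iexp (t * x)"
  have "integrable std_normal_distribution (\<lambda>x. iexp (t * x))"
    by (rule integrable_iexp) auto
  then have int: "integrable lborel ?d"
    by (subst (asm) integrable_density) auto
  \<comment> \<open>The integral is the characteristic function of the standard normal law, whose
    value is known; the factor \<open>sqrt (2 * pi)\<close> then removes the normalisation of the
    density.\<close>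
  have "(LINT x|lborel. ?d x) = char std_normal_distribution t"
    unfolding char_def by (subst integral_density) auto
  then have "has_bochner_integral lborel ?d (complex_of_real (exp (- (t\<^sup>2) / 2)))"
    using int by (simp add: has_bochner_integral_iff char_std_normal_distribution)
  then have "has_bochner_integral lborel (\<lambda>x. complex_of_real (sqrt (2 * pi)) * ?d x)
       (complex_of_real (sqrt (2 * pi)) * complex_of_real (exp (- (t\<^sup>2) / 2)))"
    by (rule has_bochner_integral_mult_right)
  moreover have "complex_of_real (sqrt (2 * pi)) * ?d x
      = exp (- of_real (x\<^sup>2) / 2 + \<i> * of_real (t * x))" for x
  proof -
    have "complex_of_real (sqrt (2 * pi)) * ?d x = of_real (sqrt (2*pi) * std_normal_density x) * iexp (t * x)"
      by (simp add: scaleR_conv_of_real)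
    also have "sqrt (2*pi) * std_normal_density x = exp (- (x\<^sup>2) / 2)"
      by (simp add: std_normal_density_def real_sqrt_mult)
    also have "of_real (exp (- (x\<^sup>2) / 2)) * iexp (t * x) = exp (- of_real (x\<^sup>2) / 2 + \<i> * of_real (t * x))"
      unfolding exp_of_real[symmetric] exp_add[symmetric] by simp
    finally show ?thesis .
  qed
  ultimately show ?thesis by simp
qed

text \<open>The square is completed with the real part of \<open>b\<close> alone, so the
  substitution is a real affine one; the imaginary part only sets the frequency of the
  characteristic function. No contour has to be moved, and \<open>?C\<close> is the factor left over
  from the square.\<close>

lemma complex_gaussian:
  fixes a :: real and b :: complex
  assumes a: "a > 0"
  shows "has_bochner_integral lborel (\<lambda>x::real. exp (- of_real (a * x\<^sup>2) + b * of_real x))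
     (complex_of_real (sqrt (pi / a)) * exp (b\<^sup>2 / of_real (4 * a)))"
proof -
  define c where "c = sqrt (2 * a)"
  define r where "r = Re b"
  define s where "s = Im b"
  have c: "c > 0" "c\<^sup>2 = 2 * a" using a by (auto simp: c_def)
  have b: "b = of_real r + \<i> * of_real s" by (simp add: r_def s_def complex_eq)
  let ?g = "\<lambda>x::real. exp (- of_real (x\<^sup>2) / 2 + \<i> * of_real (s / c * x))"
  let ?C = "exp (of_real (r\<^sup>2 / (2 * c\<^sup>2)) + \<i> * of_real (r * s / c\<^sup>2))"
  have "has_bochner_integral lborel (\<lambda>x. ?g (- (r / c) + c * x))
     (complex_of_real (sqrt (2 * pi) * exp (- ((s/c)\<^sup>2) / 2)) /\<^sub>R \<bar>c\<bar>)"
    using complex_std_gaussian[of "s / c"] c(1)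
    by (subst (asm) lborel_has_bochner_integral_real_affine_iff[of c _ _ "- (r / c)"]) auto
  then have *: "has_bochner_integral lborel (\<lambda>x. ?C * ?g (- (r / c) + c * x))
     (?C * (complex_of_real (sqrt (2 * pi) * exp (- ((s/c)\<^sup>2) / 2)) /\<^sub>R \<bar>c\<bar>))"
    by (rule has_bochner_integral_mult_right)
  have 1: "?C * ?g (- (r / c) + c * x) = exp (- of_real (a * x\<^sup>2) + b * of_real x)" for x
  proof -
    have "complex_of_real (r\<^sup>2 / (2 * c\<^sup>2)) + \<i> * complex_of_real (r * s / c\<^sup>2) +
       (- complex_of_real ((- (r / c) + c * x)\<^sup>2) / 2 + \<i> * complex_of_real (s / c * (- (r / c) + c * x)))
      = - of_real (c\<^sup>2 / 2 * x\<^sup>2) + b * of_real x"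
      using c(1) by (simp add: b field_simps power2_eq_square)
    then show ?thesis by (simp add: exp_add[symmetric] c(2))
  qed
  have 2: "?C * (complex_of_real (sqrt (2 * pi) * exp (- ((s/c)\<^sup>2) / 2)) /\<^sub>R \<bar>c\<bar>)
     = complex_of_real (sqrt (pi / a)) * exp (b\<^sup>2 / of_real (4 * a))"
  proof -
    have "sqrt (2 * pi) / c = sqrt (pi / a)"
      by (simp add: c_def real_sqrt_divide[symmetric])
    moreover have "complex_of_real (r\<^sup>2 / (2 * c\<^sup>2)) + \<i> * complex_of_real (r * s / c\<^sup>2) + of_real (- ((s/c)\<^sup>2) / 2)
       = b\<^sup>2 / of_real (2 * c\<^sup>2)"
      using c(1) by (simp add: b field_simps power2_eq_square)
    then have "?C * of_real (exp (- ((s/c)\<^sup>2) / 2)) = exp (b\<^sup>2 / of_real (4 * a))"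
      unfolding exp_of_real[symmetric] exp_add[symmetric] using c(2) by (simp add: algebra_simps)
    ultimately show ?thesis using c(1)
      by (simp add: scaleR_conv_of_real divide_simps mult_ac of_real_divide[symmetric] del: of_real_divide) simp
  qed
  show ?thesis using * unfolding 1 2 .
qed

text \<open>Lebesgue measure is determined by its values on boxes, and a box in the plane is a
  product of intervals for Re and Im. This opens plane integrals to Fubini.\<close>

lemma lborel_complex_pair:
  "distr (lborel \<Otimes>\<^sub>M lborel) borel (\<lambda>(x, y). Complex x y) = lborel"
proof (rule lborel_eqI[symmetric])
  have [measurable]: "(\<lambda>(x, y). Complex x y) \<in> borel_measurable (lborel \<Otimes>\<^sub>M lborel)"
    unfolding lborel_prod measurable_lborel2 Complex_eq split_beta'
    by (intro borel_measurable_continuous_onI continuous_intros)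
  fix l u :: complex
  assume "\<And>b. b \<in> Basis \<Longrightarrow> l \<bullet> b \<le> u \<bullet> b"
  from this[of 1] this[of \<i>] have lu: "Re l \<le> Re u" "Im l \<le> Im u" by (auto simp: Basis_complex_def)
  have "(\<lambda>(x, y). Complex x y) -` box l u = {Re l<..<Re u} \<times> {Im l<..<Im u}"
    by (auto simp: box_def Basis_complex_def)
  then show "emeasure (distr (lborel \<Otimes>\<^sub>M lborel) borel (\<lambda>(x, y). Complex x y)) (box l u) =
      ennreal (\<Prod>b\<in>Basis. (u - l) \<bullet> b)"
    using lu by (simp add: emeasure_distr space_pair_measure lborel.emeasure_pair_measure_Times
        Basis_complex_def ennreal_mult)
qed simp

lemma has_bochner_integral_complex_iterated:
  fixes F :: "real \<Rightarrow> real \<Rightarrow> complex"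
  assumes int: "integrable (lborel \<Otimes>\<^sub>M lborel) (\<lambda>(x, y). F x y)"
  assumes "\<And>y. has_bochner_integral lborel (\<lambda>x. F x y) (G y)"
    and "has_bochner_integral lborel G I"
  shows "has_bochner_integral lborel (\<lambda>w. F (Re w) (Im w)) I"
proof -
  have [measurable]: "(\<lambda>(x, y). Complex x y) \<in> borel_measurable (lborel \<Otimes>\<^sub>M lborel)"
    unfolding lborel_prod measurable_lborel2 Complex_eq split_beta'
    by (intro borel_measurable_continuous_onI continuous_intros)
  have [measurable]: "(\<lambda>(x, y). F x y) \<in> borel_measurable (borel \<Otimes>\<^sub>M borel)"
    using int by (auto dest: borel_measurable_integrable simp: lborel_prod borel_prod)
  have [measurable]: "(\<lambda>w. (Re w, Im w)) \<in> borel \<rightarrow>\<^sub>M borel \<Otimes>\<^sub>M borel"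
    unfolding borel_prod by (intro borel_measurable_continuous_onI continuous_intros)
  have "(\<lambda>w. (\<lambda>(x, y). F x y) (Re w, Im w)) \<in> borel_measurable borel"
    by measurable
  then have m [measurable]: "(\<lambda>w. F (Re w) (Im w)) \<in> borel_measurable borel" by simp
  have G: "G y = (LINT x|lborel. F x y)" for y
    using assms(2) has_bochner_integral_integral_eq by metis
  have "integrable lborel (\<lambda>w. F (Re w) (Im w))"
    unfolding lborel_complex_pair[symmetric] using int
    by (subst integrable_distr_eq) (auto simp: split_beta')
  moreover have "(LINT w|lborel. F (Re w) (Im w)) = (LINT p|(lborel \<Otimes>\<^sub>M lborel). F (fst p) (snd p))"
    unfolding lborel_complex_pair[symmetric]
    by (subst integral_distr) (auto simp: split_beta')
  moreover have "\<dots> = (LINT y|lborel. G y)"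
    unfolding G using lborel_pair.integral_snd[of F] int by (simp add: split_beta')
  ultimately show ?thesis using assms(3) by (simp add: has_bochner_integral_iff)
qed

text \<open>The quadratic form here is the one occurring in the triple products
  of the modes $\exp(i\sigma n z + z^2/2 - |z|^2/2)$ against the Bargmann kernel.\<close>

lemma has_bochner_integral_plane_gaussian:
  fixes A B :: complex
  shows "has_bochner_integral lborel
     (\<lambda>w::complex. exp (- (of_real (Re w))\<^sup>2 / 2 - 7 * (of_real (Im w))\<^sup>2 / 2 + \<i> * of_real (Re w) * of_real (Im w)
         + A * of_real (Re w) + B * of_real (Im w)))
     (of_real (pi / sqrt 2) * exp (A\<^sup>2 / 2 + (B + \<i> * A)\<^sup>2 / 16))"
proof -
  define F where "F x y = exp (- (of_real x)\<^sup>2 / 2 - 7 * (of_real y)\<^sup>2 / 2 + \<i> * of_real x * of_real y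
         + A * of_real x + B * of_real y)" for x y :: real
  \<comment> \<open>The inner integral in x. It contributes
    \<open>(A + \<i> * y)\<^sup>2 / 2\<close>, whose part -y^2/2 turns the coefficient 7/2 into 4
    and whose cross term adds \<open>\<i> * A\<close> to \<open>B\<close>.\<close>
  define G where "G y = of_real (sqrt (2 * pi)) * exp (A\<^sup>2 / 2) * exp (- of_real (4 * y\<^sup>2) + (B + \<i> * A) * of_real y)" for y :: real
  have 1: "has_bochner_integral lborel (\<lambda>x. F x y) (G y)" for y
  proof -
    have "has_bochner_integral lborel (\<lambda>x. exp (- 7 * (of_real y)\<^sup>2 / 2 + B * of_real y) *
          exp (- of_real (1/2 * x\<^sup>2) + (A + \<i> * of_real y) * of_real x))
       (exp (- 7 * (of_real y)\<^sup>2 / 2 + B * of_real y) *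
         (of_real (sqrt (pi / (1/2))) * exp ((A + \<i> * of_real y)\<^sup>2 / of_real (4 * (1/2)))))"
      by (intro has_bochner_integral_mult_right complex_gaussian) simp
    moreover have "exp (- 7 * (of_real y)\<^sup>2 / 2 + B * of_real y) *
          exp (- of_real (1/2 * x\<^sup>2) + (A + \<i> * of_real y) * of_real x) = F x y" for x
      by (simp add: F_def algebra_simps flip: exp_add)
    moreover have "exp (- 7 * (of_real y)\<^sup>2 / 2 + B * of_real y) *
         (of_real (sqrt (pi / (1/2))) * exp ((A + \<i> * of_real y)\<^sup>2 / of_real (4 * (1/2)))) = G y"
    proof -
      have "- 7 * (of_real y)\<^sup>2 / 2 + B * of_real y + (A + \<i> * of_real y)\<^sup>2 / 2
        = A\<^sup>2 / 2 + (- of_real (4 * y\<^sup>2) + (B + \<i> * A) * of_real y)"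
        by (simp add: power2_eq_square field_simps)
      then show ?thesis
        unfolding G_def mult.left_commute[of "exp _"] mult.assoc exp_add[symmetric] by simp
    qed
    ultimately show ?thesis by simp
  qed
  have 2: "has_bochner_integral lborel G (of_real (pi / sqrt 2) * exp (A\<^sup>2 / 2 + (B + \<i> * A)\<^sup>2 / 16))"
  proof -
    have "has_bochner_integral lborel G (of_real (sqrt (2 * pi)) * exp (A\<^sup>2 / 2) *
       (of_real (sqrt (pi / 4)) * exp ((B + \<i> * A)\<^sup>2 / of_real (4 * 4))))"
      unfolding G_def by (intro has_bochner_integral_mult_right complex_gaussian) simp
    moreover have "sqrt (2 * pi) * sqrt (pi / 4) = pi / sqrt 2"
      by (simp add: real_sqrt_mult real_sqrt_divide field_simps)
    then have "complex_of_real (sqrt (2 * pi)) * of_real (sqrt (pi / 4)) = of_real (pi / sqrt 2)"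
      by (metis of_real_mult)
    then have "of_real (sqrt (2 * pi)) * exp (A\<^sup>2 / 2) *
       (of_real (sqrt (pi / 4)) * exp ((B + \<i> * A)\<^sup>2 / of_real (4 * 4)))
       = of_real (pi / sqrt 2) * exp (A\<^sup>2 / 2 + (B + \<i> * A)\<^sup>2 / 16)"
      unfolding exp_add by (simp only: mult_ac) (simp add: mult.assoc[symmetric])
    ultimately show ?thesis by simp
  qed
  have [measurable]: "(\<lambda>(x, y). F x y) \<in> borel_measurable (lborel \<Otimes>\<^sub>M lborel)"
    unfolding lborel_prod measurable_lborel2 F_def split_beta'
    by (intro borel_measurable_continuous_onI continuous_intros) auto
  \<comment> \<open>The cross term in x y is purely imaginary, so the modulus is a product of two
    one-dimensional Gaussians; hence the absolute integrability that Fubini asks for.\<close>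
  have nF: "norm (F x y) = exp (- (7/2 * y\<^sup>2) + Re B * y) * exp (- (1/2 * x\<^sup>2) + Re A * x)" for x y
    by (simp add: F_def algebra_simps power2_eq_square flip: exp_add)
  have real_gauss: "integrable lborel (\<lambda>x. exp (- (a * x\<^sup>2) + b * x))" if "a > 0" for a b :: real
    using integrable_norm[OF has_bochner_integral_iff[THEN iffD1, OF complex_gaussian[OF that], THEN conjunct1], of "of_real b"]
    by simp
  have "integrable (lborel \<Otimes>\<^sub>M lborel) (\<lambda>(x, y). F x y)"
  proof (rule lborel_pair.Fubini_integrable)
    show "integrable lborel (\<lambda>x. LINT y|lborel. norm ((\<lambda>(x, y). F x y) (x, y)))"
      unfolding split_conv nF using real_gauss[of "1/2" "Re A"] by simp
    have "integrable lborel (F x)" for x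
    proof (rule integrable_norm_cancel)
      show "integrable lborel (\<lambda>y. norm (F x y))"
        unfolding nF using real_gauss[of "7/2" "Re B"] by simp
    qed (simp add: F_def)
    then show "AE x in lborel. integrable lborel (\<lambda>y. (\<lambda>(x, y). F x y) (x, y))"
      by simp
  qed simp
  from has_bochner_integral_complex_iterated[OF this 1 2] show ?thesis
    unfolding F_def .
qed

section \<open>Periodic entire functions with finitely many zeros\<close>

text \<open>Each induction step strips one zero with its full multiplicity, so the number of
  distinct zeros drops by one. Keeping the roots of \<open>p\<close> inside \<open>S\<close> yields
  a nonzero constant term when \<open>S\<close> is the punctured plane.\<close>

lemma holomorphic_factor_finite_zeros:
  fixes f :: "complex \<Rightarrow> complex"
  assumes "f holomorphic_on S" "open S" "connected S" "S \<noteq> {}" "finite {z \<in> S. f z = 0}"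
  shows "\<exists>p q. q holomorphic_on S \<and> (\<forall>z\<in>S. q z \<noteq> 0 \<and> f z = poly p z * q z) \<and>
           (\<forall>z. poly p z = 0 \<longrightarrow> z \<in> S)"
  using assms
proof (induction "card {z \<in> S. f z = 0}" arbitrary: f rule: less_induct)
  case less
  show ?case
  proof (cases "{z \<in> S. f z = 0} = {}")
    case True
    then show ?thesis using less.prems
      by (intro exI[of _ "1 :: complex poly"] exI[of _ f]) auto
  next
    case False
    then obtain \<xi> where \<xi>: "\<xi> \<in> S" "f \<xi> = 0" by auto
    have "\<not> f constant_on S"
    proof
      assume "f constant_on S"
      then have "{z \<in> S. f z = 0} = S" using \<xi> by (auto simp: constant_on_def)
      then have "finite S" using less.prems(5) by simp
      then show False using finite_imp_not_open less.prems(2,4) by blast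
    qed
    then obtain g r n where g: "0 < (n::nat)" "0 < r" "ball \<xi> r \<subseteq> S" "g holomorphic_on ball \<xi> r"
        "\<And>w. w \<in> ball \<xi> r \<Longrightarrow> f w = (w - \<xi>)^n * g w"
        "\<And>w. w \<in> ball \<xi> r \<Longrightarrow> g w \<noteq> 0"
      by (rule holomorphic_factor_zero_nonconstant[OF less.prems(1-3) \<xi>]) (rule that)
    \<comment> \<open>The value \<open>g \<xi>\<close> fills the removable singularity: near
      \<open>\<xi>\<close> this is \<open>g\<close>, elsewhere the plain quotient.\<close>
    define q where "q w = (if w = \<xi> then g \<xi> else f w / (w - \<xi>)^n)" for w
    have "q holomorphic_on ball \<xi> r"
      by (rule holomorphic_transform[OF g(4)]) (use g(5) in \<open>auto simp: q_def\<close>)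
    moreover have "q holomorphic_on S - {\<xi>}"
    proof (rule holomorphic_transform)
      show "(\<lambda>w. f w / (w - \<xi>)^n) holomorphic_on S - {\<xi>}"
        using less.prems(1) by (intro holomorphic_intros) (auto intro: holomorphic_on_subset)
    qed (auto simp: q_def)
    ultimately have "q holomorphic_on ball \<xi> r \<union> (S - {\<xi>})"
      using less.prems(2) by (intro holomorphic_on_Un) auto
    moreover have "ball \<xi> r \<union> (S - {\<xi>}) = S" using g(2,3) by auto
    ultimately have holq: "q holomorphic_on S" by simp
    have g\<xi>: "g \<xi> \<noteq> 0" using g(2,6) by simp
    have zq: "{z \<in> S. q z = 0} = {z \<in> S. f z = 0} - {\<xi>}"
      using g\<xi> by (auto simp: q_def)
    then have "card {z \<in> S. q z = 0} < card {z \<in> S. f z = 0}"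
      using \<xi> less.prems(5) by (metis (mono_tags, lifting) card_Diff1_less mem_Collect_eq)
    moreover have "finite {z \<in> S. q z = 0}" unfolding zq using less.prems(5) by simp
    ultimately obtain p Q where pQ: "Q holomorphic_on S" "\<forall>z\<in>S. Q z \<noteq> 0 \<and> q z = poly p z * Q z"
        "\<forall>z. poly p z = 0 \<longrightarrow> z \<in> S"
      using less.hyps[OF _ holq less.prems(2-4)] by blast
    have "f z = (z - \<xi>) ^ n * q z" for z
      using g(1) \<xi> by (simp add: q_def)
    then show ?thesis
      using pQ \<xi> by (intro exI[of _ "[:- \<xi>, 1:] ^ n * p"] exI[of _ Q]) (auto simp: mult.assoc)
  qed
qed

text \<open>By periodicity the value of g at a logarithm of w divided by c does not depend on the
  branch. Holomorphy across the cut of \<open>Ln\<close> is checked with the branch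
  \<open>Ln (- w) + \<i> * pi\<close>, which is cut along the other half-axis; the two slit planes
  cover everything but 0.\<close>

lemma periodic_factors_through_exp:
  fixes g :: "complex \<Rightarrow> complex" and c :: complex
  assumes hol: "g holomorphic_on UNIV" and c: "c \<noteq> 0"
    and per: "\<And>z. g (z + 2 * of_real pi * \<i> / c) = g z"
  obtains h where "h holomorphic_on - {0}" "\<And>z. g z = h (exp (c * z))"
proof -
  define h where "h w = g (Ln w / c)" for w
  interpret periodic_fun_simple g "2 * of_real pi * \<i> / c"
    by unfold_locales (rule per)
  have eq: "g (x / c) = g (y / c)" if "exp x = exp y" for x y
  proof -
    obtain n :: int where "x = y + of_int (2 * n) * of_real pi * \<i>"
      using \<open>exp x = exp y\<close> by (auto simp: exp_eq)
    then have "x / c = y / c + of_int n * (2 * of_real pi * \<i> / c)"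
      by (simp add: add_divide_distrib)
    then show ?thesis by (metis plus_of_int)
  qed
  have "h holomorphic_on - \<real>\<^sub>\<le>\<^sub>0"
    unfolding h_def
    by (rule holomorphic_on_compose_gen[OF _ hol, unfolded o_def])
       (use c in \<open>auto intro!: holomorphic_intros\<close>)
  moreover have "h holomorphic_on - \<real>\<^sub>\<ge>\<^sub>0"
  proof (rule holomorphic_transform)
    show "(\<lambda>w. g ((Ln (- w) + \<i> * of_real pi) / c)) holomorphic_on - \<real>\<^sub>\<ge>\<^sub>0"
      by (rule holomorphic_on_compose_gen[OF _ hol, unfolded o_def])
         (use c in \<open>auto intro!: holomorphic_intros\<close>)
    fix w :: complex assume "w \<in> - \<real>\<^sub>\<ge>\<^sub>0"
    then have "w \<noteq> 0" by auto
    then show "g ((Ln (- w) + \<i> * of_real pi) / c) = h w"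
      unfolding h_def by (intro eq) (simp add: exp_add)
  qed
  ultimately have "h holomorphic_on - \<real>\<^sub>\<le>\<^sub>0 \<union> - \<real>\<^sub>\<ge>\<^sub>0"
    by (intro holomorphic_on_Un) (auto simp: open_Compl)
  moreover have "- \<real>\<^sub>\<le>\<^sub>0 \<union> - \<real>\<^sub>\<ge>\<^sub>0 = - {0 :: complex}"
    by (auto simp: complex_nonpos_Reals_iff complex_nonneg_Reals_iff complex_eq_iff)
  ultimately have "h holomorphic_on - {0}" by simp
  moreover have "g z = h (exp (c * z))" for z
    using eq[of "c * z" "Ln (exp (c * z))"] c by (simp add: h_def)
  ultimately show thesis using that by blast
qed

text \<open>Borel--Caratheodory at half the radius: apply the Schwarz lemma to $f/(2A-f)$.\<close>

lemma norm_le_if_Re_less: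
  fixes f :: "complex \<Rightarrow> complex"
  assumes hol: "f holomorphic_on ball 0 R" and R: "R > 0" and f0: "f 0 = 0"
    and re: "\<And>z. norm z < R \<Longrightarrow> Re (f z) < A"
    and z: "norm z \<le> R / 2"
  shows "norm (f z) \<le> 2 * A"
proof -
  have A: "A > 0" using re[of 0] R f0 by simp
  \<comment> \<open>Points with real part below A are closer to 0 than to 2A; this is what places
    \<open>\<phi>\<close> in the unit disc.\<close>
  have less: "norm (f w) < norm (2 * of_real A - f w)" if "norm w < R" for w
  proof -
    have "A * Re (f w) < A * A" using re[OF that] A by simp
    then have "(norm (f w))\<^sup>2 < (norm (2 * of_real A - f w))\<^sup>2"
      unfolding cmod_power2 by (simp add: power2_eq_square algebra_simps)
    then show ?thesis by (rule power2_less_imp_less) simp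
  qed
  define \<phi> where "\<phi> \<zeta> = f (of_real R * \<zeta>) / (2 * of_real A - f (of_real R * \<zeta>))" for \<zeta>
  have in_ball: "norm (of_real R * \<zeta>) < R" if "norm \<zeta> < 1" for \<zeta> :: complex
    using that R by (simp add: norm_mult)
  have "(\<lambda>\<zeta>. f (of_real R * \<zeta>)) holomorphic_on ball 0 1"
    by (rule holomorphic_on_compose_gen[OF _ hol, unfolded o_def])
       (use in_ball in \<open>auto intro!: holomorphic_intros\<close>)
  moreover have "2 * of_real A - f (of_real R * \<zeta>) \<noteq> 0" if "norm \<zeta> < 1" for \<zeta>
    using less[OF in_ball[OF that]] norm_ge_zero[of "f (of_real R * \<zeta>)"] by (intro notI) simp
  ultimately have "\<phi> holomorphic_on ball 0 1"
    unfolding \<phi>_def by (intro holomorphic_intros) auto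
  moreover have "norm (\<phi> \<zeta>) < 1" if "norm \<zeta> < 1" for \<zeta>
    using less[OF in_ball[OF that]] norm_ge_zero[of "f (of_real R * \<zeta>)"]
    by (simp add: \<phi>_def norm_divide divide_simps)
  moreover have "norm (z / of_real R) < 1" using z R by (simp add: norm_divide)
  ultimately have "norm (\<phi> (z / of_real R)) \<le> norm (z / of_real R)"
    using Schwarz_Lemma(1)[of \<phi> "z / of_real R"] f0 by (simp add: \<phi>_def)
  also have "\<dots> \<le> 1 / 2" using z R by (simp add: norm_divide divide_simps)
  finally have *: "norm (f z) / norm (2 * of_real A - f z) \<le> 1 / 2"
    using R by (simp add: \<phi>_def norm_divide)
  have "norm (2 * of_real A - f z) > 0"
    using less[of z] z R norm_ge_zero[of "f z"] by linarith
  with * have "2 * norm (f z) \<le> norm (2 * of_real A - f z)" by (simp add: divide_simps)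
  also have "\<dots> \<le> 2 * A + norm (f z)"
    using norm_triangle_ineq4[of "2 * of_real A" "f z"] A by (simp add: norm_mult)
  finally show ?thesis by simp
qed

lemma entire_Re_le_power_imp_polynomial:
  fixes f :: "complex \<Rightarrow> complex"
  assumes hol: "f holomorphic_on UNIV" and re: "\<And>z. Re (f z) \<le> A + B * norm z ^ n"
  shows "f z = (\<Sum>k\<le>n. (deriv ^^ k) f 0 / fact k * z ^ k)"
proof (rule Liouville_polynomial[OF hol])
  fix z :: complex assume z: "1 \<le> norm z"
  define R where "R = 2 * norm z"
  \<comment> \<open>A bound for the real part of f - f 0 on the disc of radius 2|z|; the final 1
    makes it strict. The constants in it are absorbed afterwards into the power of |z|, as |z| is at
    least 1.\<close>
  define A' where "A' = \<bar>A\<bar> + \<bar>B\<bar> * R ^ n + norm (f 0) + 1"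
  have "norm (f z - f 0) \<le> 2 * A'"
  proof (rule norm_le_if_Re_less[where f = "\<lambda>z. f z - f 0" and R = R])
    show "(\<lambda>z. f z - f 0) holomorphic_on ball 0 R"
      by (intro holomorphic_intros holomorphic_on_subset[OF hol]) auto
    fix w :: complex assume w: "norm w < R"
    have "B * norm w ^ n \<le> \<bar>B\<bar> * R ^ n"
      using w by (intro mult_mono power_mono) auto
    moreover have "- Re (f 0) \<le> norm (f 0)" using abs_Re_le_cmod[of "f 0"] by linarith
    ultimately show "Re (f w - f 0) < A'"
      using re[of w] by (simp add: A'_def)
  qed (use z in \<open>auto simp: R_def\<close>)
  then have "norm (f z) \<le> norm (f 0) + 2 * A'"
    using norm_triangle_ineq2[of "f z" "f 0"] by linarith
  also have "\<dots> = 3 * norm (f 0) + 2 * \<bar>A\<bar> + 2 + 2 * \<bar>B\<bar> * 2 ^ n * norm z ^ n"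
    by (simp add: A'_def R_def power_mult_distrib)
  also have "\<dots> \<le> (3 * norm (f 0) + 2 * \<bar>A\<bar> + 2) * norm z ^ n + 2 * \<bar>B\<bar> * 2 ^ n * norm z ^ n"
    using mult_left_mono[OF one_le_power[OF z, of n], of "3 * norm (f 0) + 2 * \<bar>A\<bar> + 2"]
    by (intro add_right_mono) simp
  finally show "norm (f z) \<le> (3 * norm (f 0) + 2 * \<bar>A\<bar> + 2 + 2 * \<bar>B\<bar> * 2 ^ n) * norm z ^ n"
    by (simp add: algebra_simps)
qed

text \<open>The increment of G over one period is affine in z and takes values in 2 pi i Z. A
  nonconstant affine function would take every complex value, so the quadratic coefficient
  vanishes.\<close>

lemma exp_quadratic_periodic:
  fixes G :: "complex \<Rightarrow> complex" and c :: complex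
  assumes G: "\<And>z. G z = a0 + a1 * z + a2 * z\<^sup>2"
    and c: "c \<noteq> 0" and per: "\<And>z. exp (G (z + 2 * of_real pi * \<i> / c)) = exp (G z)"
  obtains m :: int where "\<And>z. exp (G z) = exp a0 * exp (of_int m * c * z)"
proof -
  define p where "p = 2 * of_real pi * \<i> / c"
  have p: "p \<noteq> 0" using c by (simp add: p_def)
  have diff: "G (z + p) - G z = a1 * p + a2 * p\<^sup>2 + 2 * a2 * p * z" for z
    by (simp add: G power2_eq_square algebra_simps)
  have E: "\<exists>n::int. a1 * p + a2 * p\<^sup>2 + 2 * a2 * p * z = of_int (2 * n) * of_real pi * \<i>" for z
  proof -
    obtain n :: int where "G (z + p) = G z + (of_int (2 * n) * pi) * \<i>"
      using iffD1[OF exp_eq per[of z]] unfolding p_def by metis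
    then have "G (z + p) - G z = of_int (2 * n) * of_real pi * \<i>" by simp
    then show ?thesis unfolding diff by blast
  qed
  have "a2 = 0"
  proof (rule ccontr)
    assume "a2 \<noteq> 0"
    \<comment> \<open>Chosen so that the increment equals pi i, halfway between two admissible
      values.\<close>
    define z where "z = (of_real pi * \<i> - a1 * p - a2 * p\<^sup>2) / (2 * a2 * p)"
    have "2 * a2 * p * z = of_real pi * \<i> - a1 * p - a2 * p\<^sup>2"
      using p \<open>a2 \<noteq> 0\<close> by (simp add: z_def)
    then have "a1 * p + a2 * p\<^sup>2 + 2 * a2 * p * z = of_real pi * \<i>" by simp
    then obtain n :: int where "of_real pi * \<i> = of_int (2 * n) * of_real pi * \<i>"
      using E by metis
    from arg_cong[OF this, of Im] have "pi = of_int (2 * n) * pi" by simp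
    then have "of_int (2 * n) = (1::real)" by simp
    then have "2 * n = 1" by (simp only: of_int_eq_1_iff)
    then show False by presburger
  qed
  obtain m :: int where "a1 * p + a2 * p\<^sup>2 + 2 * a2 * p * 0 = of_int (2 * m) * of_real pi * \<i>"
    using E[of 0] by blast
  then have "a1 * p = of_int (2 * m) * of_real pi * \<i>" using \<open>a2 = 0\<close> by simp
  then have "a1 * p = of_int m * c * p" using c by (simp add: p_def)
  then have "a1 = of_int m * c" using p by simp
  then show thesis using that[of m] \<open>a2 = 0\<close> by (simp add: G exp_add)
qed

lemma poly_norm_bounded_below_at_infinity:
  fixes p :: "complex poly"
  assumes "p \<noteq> 0"
  obtains \<delta> R where "\<delta> > 0" "\<And>w. norm w \<ge> R \<Longrightarrow> norm (poly p w) \<ge> \<delta>"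
proof (cases "degree p = 0")
  case True
  then obtain a where "p = [:a:]" by (rule degree_eq_zeroE)
  then show thesis using assms that[of "norm a" 0] by auto
next
  case False
  then have "filterlim (poly p) at_infinity at_infinity"
    by (intro filterlim_poly_at_infinity) simp
  then have "\<forall>\<^sub>F w in at_infinity. 1 \<le> norm (poly p w)"
    by (simp add: filterlim_at_infinity[of 0])
  then show thesis using that[of 1] by (auto simp: eventually_at_infinity)
qed

lemma poly_norm_bounded_below_near_zero:
  fixes p :: "complex poly"
  assumes "poly p 0 \<noteq> 0"
  obtains \<delta> r where "\<delta> > 0" "r > 0" "\<And>w. norm w \<le> r \<Longrightarrow> norm (poly p w) \<ge> \<delta>"
proof -
  have "((\<lambda>w. norm (poly p w)) \<longlongrightarrow> norm (poly p 0)) (at 0)"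
    by (intro tendsto_intros isContD[of _ "poly p"] poly_isCont)
  moreover have "norm (poly p 0) / 2 < norm (poly p 0)" using assms by simp
  ultimately have "\<forall>\<^sub>F w in at 0. norm (poly p w) > norm (poly p 0) / 2"
    by (rule order_tendstoD(1))
  then obtain d where d: "d > 0" "\<And>w. w \<noteq> 0 \<Longrightarrow> dist w 0 < d \<Longrightarrow> norm (poly p w) > norm (poly p 0) / 2"
    by (auto simp: eventually_at)
  have "norm (poly p w) \<ge> norm (poly p 0) / 2" if "norm w \<le> d / 2" for w
    using d(1) d(2)[of w] that by (cases "w = 0") auto
  then show thesis using assms d(1) by (intro that[of "norm (poly p 0) / 2" "d / 2"]) auto
qed

lemma periodic_entire_finite_zeros_imp_trig_polynomial:
  fixes g :: "complex \<Rightarrow> complex" and c :: complex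
  assumes hol: "g holomorphic_on UNIV" and c: "c \<noteq> 0"
    and per: "\<And>z. g (z + 2 * of_real pi * \<i> / c) = g z"
    and growth: "\<And>z. norm (g z) \<le> K * exp (B * (norm z)\<^sup>2)"
    and fin: "finite ((\<lambda>z. exp (c * z)) ` {z. g z = 0})"
  obtains S :: "int set" and a where "finite S" "\<And>z. g z = (\<Sum>n\<in>S. a n * exp (of_int n * c * z))"
proof -
  obtain h where h: "h holomorphic_on - {0}" "\<And>z. g z = h (exp (c * z))"
    using periodic_factors_through_exp[OF hol c per] by blast
  have surj: "\<exists>z. w = exp (c * z)" if "w \<noteq> 0" for w
    using that c by (intro exI[of _ "Ln w / c"]) simp
  have "{w \<in> - {0}. h w = 0} \<subseteq> (\<lambda>z. exp (c * z)) ` {z. g z = 0}"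
    using surj h(2) by fastforce
  then have "finite {w \<in> - {0}. h w = 0}" using fin finite_subset by blast
  moreover have "connected (- {0 :: complex})" by (intro connected_punctured_universe) simp
  moreover have "- {0 :: complex} \<noteq> {}" by (metis ComplI empty_iff singletonD zero_neq_one)
  ultimately obtain P q where P: "q holomorphic_on - {0}"
      "\<And>w. w \<noteq> 0 \<Longrightarrow> q w \<noteq> 0" "\<And>w. w \<noteq> 0 \<Longrightarrow> h w = poly P w * q w" "\<And>w. poly P w = 0 \<Longrightarrow> w \<noteq> 0"
    using holomorphic_factor_finite_zeros[OF h(1)] by (auto simp: open_Compl)
  \<comment> \<open>Since the roots avoid 0, P is bounded below near the puncture as well as near
    infinity.\<close>
  have P0: "poly P 0 \<noteq> 0" using P(4) by blast
  define Q where "Q z = q (exp (c * z))" for z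
  have gPQ: "g z = poly P (exp (c * z)) * Q z" for z by (simp add: h(2) Q_def P(3))
  have holQ: "Q holomorphic_on UNIV"
    unfolding Q_def by (rule holomorphic_on_compose_gen[OF _ P(1), unfolded o_def])
       (auto intro!: holomorphic_intros)
  have Qnz: "Q z \<noteq> 0" for z by (simp add: Q_def P(2))
  have Qper: "Q (z + 2 * of_real pi * \<i> / c) = Q z" for z
  proof -
    have "exp (c * (z + 2 * of_real pi * \<i> / c)) = exp (c * z)"
      using c by (simp add: distrib_left exp_add)
    then show ?thesis by (simp add: Q_def)
  qed
  obtain \<delta>1 R where R: "\<delta>1 > 0" "\<And>w. norm w \<ge> R \<Longrightarrow> norm (poly P w) \<ge> \<delta>1"
    using poly_norm_bounded_below_at_infinity[of P] P0 by (metis poly_0)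
  obtain \<delta>2 r where r: "\<delta>2 > 0" "r > 0" "\<And>w. norm w \<le> r \<Longrightarrow> norm (poly P w) \<ge> \<delta>2"
    using poly_norm_bounded_below_near_zero[OF P0] by blast
  define \<delta> where "\<delta> = min \<delta>1 \<delta>2"
  have \<delta>: "\<delta> > 0" using R(1) r(1) by (simp add: \<delta>_def)
  \<comment> \<open>The annulus between the two regions where P is bounded below; it contains all
    roots of P.\<close>
  define N where "N = cball (0::complex) R - ball 0 r"
  have "compact N" unfolding N_def by (intro compact_diff) auto
  moreover have "N \<subseteq> - {0}" using r(2) by (auto simp: N_def)
  then have "continuous_on N q"
    using P(1) holomorphic_on_imp_continuous_on continuous_on_subset by blast
  ultimately obtain D where D: "\<And>w. w \<in> N \<Longrightarrow> norm (q w) \<le> D"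
    by (metis compact_continuous_image compact_imp_bounded bounded_iff imageI)
  \<comment> \<open>The 1 keeps \<open>K'\<close> positive, so that its logarithm can be used below;
    taking \<open>B'\<close> nonnegative makes the exponential at least 1, as the bound on the
    annulus needs.\<close>
  define K' where "K' = max 1 (max D (K / \<delta>))"
  define B' where "B' = max 0 B"
  have Qbound: "norm (Q z) \<le> K' * exp (B' * (norm z)\<^sup>2)" for z
  proof (cases "exp (c * z) \<in> N")
    case True
    then have "norm (Q z) \<le> K' * 1" using D[OF True] by (simp add: Q_def K'_def)
    also have "\<dots> \<le> K' * exp (B' * (norm z)\<^sup>2)"
      by (intro mult_left_mono) (auto simp: K'_def B'_def)
    finally show ?thesis .
  next
    case False
    then have "norm (poly P (exp (c * z))) \<ge> \<delta>"
      using R(2)[of "exp (c * z)"] r(3)[of "exp (c * z)"] by (auto simp: N_def \<delta>_def)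
    then have "\<delta> * norm (Q z) \<le> norm (g z)"
      by (simp add: gPQ norm_mult mult_right_mono)
    also have "\<dots> \<le> K * exp (B * (norm z)\<^sup>2)" by (rule growth)
    finally have "norm (Q z) \<le> K / \<delta> * exp (B * (norm z)\<^sup>2)"
      using \<delta> by (simp add: field_simps)
    also have "\<dots> \<le> K' * exp (B' * (norm z)\<^sup>2)"
      by (intro mult_mono) (auto simp: K'_def B'_def intro!: mult_right_mono)
    finally show ?thesis .
  qed
  obtain G where G: "G holomorphic_on UNIV" "\<And>z. Q z = exp (G z)"
    using contractible_imp_holomorphic_log[OF holQ] Qnz by auto
  have "Re (G z) \<le> ln K' + B' * norm z ^ 2" for z
  proof -
    have "exp (Re (G z)) \<le> exp (ln K' + B' * (norm z)\<^sup>2)"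
      using Qbound[of z] by (simp add: G(2) exp_add K'_def)
    then show ?thesis by simp
  qed
  note G_sum = entire_Re_le_power_imp_polynomial[OF G(1) this]
  have Gq: "G z = G 0 + deriv G 0 * z + (deriv ^^ 2) G 0 / 2 * z\<^sup>2" for z
    using G_sum[of z] by (simp add: numeral_2_eq_2)
  have Gper: "exp (G (z + 2 * of_real pi * \<i> / c)) = exp (G z)" for z
    using Qper by (simp flip: G(2))
  obtain m :: int where m: "\<And>z. exp (G z) = exp (G 0) * exp (of_int m * c * z)"
    by (rule exp_quadratic_periodic[of G "G 0" "deriv G 0" "(deriv ^^ 2) G 0 / 2" c, OF Gq c Gper]) (rule that)
  \<comment> \<open>P contributes the frequencies from 0 to its degree; the factor
    \<open>exp (of_int m * c * z)\<close> shifts them by m, which may be negative.\<close>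
  have "g z = (\<Sum>n\<in>{m..m + int (degree P)}. exp (G 0) * coeff P (nat (n - m)) * exp (of_int n * c * z))" for z
  proof -
    have e: "exp (of_int (m + int k) * c * z) = exp (c * z) ^ k * exp (of_int m * c * z)" for k
      unfolding exp_of_nat_mult[symmetric] exp_add[symmetric] by (simp add: algebra_simps)
    have "g z = (\<Sum>k\<le>degree P. coeff P k * exp (c * z) ^ k) * (exp (G 0) * exp (of_int m * c * z))"
      by (simp add: gPQ G(2) m[of z] poly_altdef)
    also have "\<dots> = (\<Sum>k\<le>degree P. exp (G 0) * coeff P k * exp (of_int (m + int k) * c * z))"
      unfolding e sum_distrib_right by (rule sum.cong) (simp_all add: mult_ac)
    also have "\<dots> = (\<Sum>n\<in>{m..m + int (degree P)}. exp (G 0) * coeff P (nat (n - m)) * exp (of_int n * c * z))"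
      by (rule sum.reindex_bij_witness[of _ "\<lambda>n. nat (n - m)" "\<lambda>k. m + int k"]) auto
    finally show ?thesis .
  qed
  then show thesis by (intro that[of "{m..m + int (degree P)}"]) auto
qed

section \<open>Modes and their triple products\<close>

lemma sum_exp_negative_tendsto_0:
  fixes b :: "'a \<Rightarrow> complex" and \<nu> :: "'a \<Rightarrow> int"
  assumes "finite J" "\<And>j. j \<in> J \<Longrightarrow> \<nu> j < 0"
  shows "((\<lambda>r::real. \<Sum>j\<in>J. b j * exp (of_int (\<nu> j) * of_real r)) \<longlongrightarrow> 0) at_top"
proof (rule tendsto_null_sum)
  fix j assume "j \<in> J"
  have "((\<lambda>r. exp (of_int (\<nu> j) * r)) \<longlongrightarrow> (0::real)) at_top"
    using assms(2)[OF \<open>j \<in> J\<close>]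
    by (intro filterlim_compose[OF exp_at_bot] filterlim_tendsto_neg_mult_at_bot[OF tendsto_const _ filterlim_ident]) auto
  then have "((\<lambda>r::real. exp (of_int (\<nu> j) * of_real r) :: complex) \<longlongrightarrow> 0) at_top"
    by (intro tendsto_norm_zero_cancel[of "\<lambda>r::real. exp (of_int (\<nu> j) * of_real r) :: complex"]) simp
  then show "((\<lambda>r::real. b j * exp (of_int (\<nu> j) * of_real r)) \<longlongrightarrow> 0) at_top"
    by (rule tendsto_mult_right_zero)
qed

text \<open>Divide by the top exponential and let r tend to infinity. The terms are indexed by an
  arbitrary set with a frequency map because lower frequencies may be hit repeatedly; only the top
  one must be hit once.\<close>

lemma top_coefficient_eq_0:
  fixes b :: "'a \<Rightarrow> complex" and \<nu> :: "'a \<Rightarrow> int"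
  assumes "finite J" "j0 \<in> J" and less: "\<And>j. j \<in> J \<Longrightarrow> j \<noteq> j0 \<Longrightarrow> \<nu> j < \<nu> j0"
    and zero: "\<And>r::real. (\<Sum>j\<in>J. b j * exp (of_int (\<nu> j) * of_real r)) = 0"
  shows "b j0 = 0"
proof -
  have "(\<Sum>j\<in>J - {j0}. b j * exp (of_int (\<nu> j - \<nu> j0) * of_real r)) = - b j0" for r :: real
  proof -
    have "(\<Sum>j\<in>J. b j * exp (of_int (\<nu> j - \<nu> j0) * of_real r))
       = exp (- of_int (\<nu> j0) * of_real r) * (\<Sum>j\<in>J. b j * exp (of_int (\<nu> j) * of_real r))"
      unfolding sum_distrib_left
      by (rule sum.cong) (simp_all add: left_diff_distrib exp_diff exp_minus field_simps)
    then have "(\<Sum>j\<in>J. b j * exp (of_int (\<nu> j - \<nu> j0) * of_real r)) = 0" by (simp add: zero)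
    then show ?thesis
      using assms(1,2) by (simp add: sum.remove eq_neg_iff_add_eq_0 add.commute)
  qed
  moreover have "((\<lambda>r::real. \<Sum>j\<in>J - {j0}. b j * exp (of_int (\<nu> j - \<nu> j0) * of_real r)) \<longlongrightarrow> 0) at_top"
    using assms(1) less by (intro sum_exp_negative_tendsto_0) auto
  ultimately have "((\<lambda>r::real. - b j0) \<longlongrightarrow> 0) at_top" by simp
  then show ?thesis by (simp add: tendsto_const_iff)
qed

text \<open>With \<open>\<sigma> = 2 * pi / \<gamma>\<close> this is \<open>psi \<gamma> n\<close>
  stripped of its positive constant.\<close>

definition mode :: "real \<Rightarrow> int \<Rightarrow> complex \<Rightarrow> complex" where
  "mode \<sigma> n z = exp (\<i> * of_real \<sigma> * of_int n * z + z\<^sup>2 / 2 - of_real ((cmod z)\<^sup>2) / 2)"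

text \<open>The constant produced by the plane Gaussian: the first square comes from
  \<open>(B + \<i> * A)\<^sup>2 / 16\<close>, the second from the z-free part of
  \<open>A\<^sup>2 / 2\<close>.\<close>

definition triple_coeff :: "real \<Rightarrow> int \<Rightarrow> int \<Rightarrow> int \<Rightarrow> real" where
  "triple_coeff \<sigma> k l m =
     exp (\<sigma>\<^sup>2 * ((of_int (k + m))\<^sup>2 / 4 - (of_int (k + m - l))\<^sup>2 / 2)) / sqrt 2"

lemma triple_coeff_nonzero: "triple_coeff \<sigma> k l m \<noteq> 0"
  by (simp add: triple_coeff_def)

lemma mode_nonzero [simp]: "mode \<sigma> n z \<noteq> 0"
  by (simp add: mode_def)

lemma mode_eq_exp_mult:
  "mode \<sigma> n z = exp (\<i> * of_real \<sigma> * of_int n * z) * exp (z\<^sup>2 / 2 - of_real ((cmod z)\<^sup>2) / 2)"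
  unfolding mode_def exp_add[symmetric] by (simp add: add_diff_eq)

text \<open>In \<open>B + \<i> * A\<close> both z and l cancel, so z enters the result only through
  \<open>A\<^sup>2 / 2\<close>, and this reproduces the exponent of a mode of frequency k + m -
  l.\<close>

lemma bargmann_integral_mode_triple:
  "has_bochner_integral lborel
     (\<lambda>w. exp (cnj w * z - of_real ((cmod w)\<^sup>2) / 2) * (mode \<sigma> k w * cnj (mode \<sigma> l w) * mode \<sigma> m w))
     (of_real (pi * triple_coeff \<sigma> k l m) * exp (\<i> * of_real \<sigma> * of_int (k + m - l) * z + z\<^sup>2 / 2))"
proof -
  \<comment> \<open>\<open>A\<close> and \<open>B\<close> collect the coefficients of Re w and Im w
    in the total exponent of the kernel and the three modes.\<close>
  define A where "A = \<i> * of_real \<sigma> * of_int (k + m - l) + z"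
  define B where "B = - of_real \<sigma> * of_int (k + m + l) - \<i> * z"
  have 1: "exp (cnj w * z - of_real ((cmod w)\<^sup>2) / 2) * (mode \<sigma> k w * cnj (mode \<sigma> l w) * mode \<sigma> m w)
     = exp (- (of_real (Re w))\<^sup>2 / 2 - 7 * (of_real (Im w))\<^sup>2 / 2 + \<i> * of_real (Re w) * of_real (Im w)
         + A * of_real (Re w) + B * of_real (Im w))" for w
  proof -
    define x where "x = complex_of_real (Re w)"
    define y where "y = complex_of_real (Im w)"
    have w: "w = x + \<i> * y" unfolding x_def y_def by (rule complex_eq)
    have cw: "cnj w = x - \<i> * y" unfolding x_def y_def by (simp add: complex_eq_iff)
    have nw: "complex_of_real ((cmod w)\<^sup>2) = x\<^sup>2 + y\<^sup>2" unfolding x_def y_def by (simp add: cmod_power2)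
    have exponent: "cnj w * z - (x\<^sup>2 + y\<^sup>2) / 2 + ((\<i> * of_real \<sigma> * of_int k * w + w\<^sup>2 / 2 - (x\<^sup>2 + y\<^sup>2) / 2)
        + (- \<i> * of_real \<sigma> * of_int l * cnj w + (cnj w)\<^sup>2 / 2 - (x\<^sup>2 + y\<^sup>2) / 2)
        + (\<i> * of_real \<sigma> * of_int m * w + w\<^sup>2 / 2 - (x\<^sup>2 + y\<^sup>2) / 2))
      = - x\<^sup>2 / 2 - 7 * y\<^sup>2 / 2 + \<i> * x * y + A * x + B * y"
      unfolding cw unfolding w A_def B_def by (simp add: power2_eq_square field_simps)
    have cnj_mode: "cnj (mode \<sigma> l w) = exp (- \<i> * of_real \<sigma> * of_int l * cnj w + (cnj w)\<^sup>2 / 2 - (x\<^sup>2 + y\<^sup>2) / 2)"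
      unfolding mode_def exp_cnj nw[symmetric] by simp
    show ?thesis
      unfolding cnj_mode unfolding mode_def nw exp_add[symmetric] exponent x_def[symmetric] y_def[symmetric] ..
  qed
  have BA: "B + \<i> * A = - 2 * of_real \<sigma> * of_int (k + m)"
    by (simp add: A_def B_def algebra_simps)
  have exponent: "A\<^sup>2 / 2 + (B + \<i> * A)\<^sup>2 / 16 = of_real (\<sigma>\<^sup>2 * ((of_int (k + m))\<^sup>2 / 4 - (of_int (k + m - l))\<^sup>2 / 2))
     + (\<i> * of_real \<sigma> * of_int (k + m - l) * z + z\<^sup>2 / 2)"
    unfolding BA by (simp add: A_def power2_eq_square field_simps)
  have 2: "of_real (pi / sqrt 2) * exp (A\<^sup>2 / 2 + (B + \<i> * A)\<^sup>2 / 16)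
     = of_real (pi * triple_coeff \<sigma> k l m) * exp (\<i> * of_real \<sigma> * of_int (k + m - l) * z + z\<^sup>2 / 2)"
    unfolding exponent exp_add exp_of_real triple_coeff_def by simp
  show ?thesis
    using has_bochner_integral_plane_gaussian[of A B] unfolding 1 2 .
qed

lemma LLL_proj_cubic:
  assumes v: "\<And>w. v w = (\<Sum>n\<in>S. c n * mode \<sigma> n w)"
  shows "LLL_proj (\<lambda>w. of_real ((cmod (v w))\<^sup>2) * v w) z =
    (\<Sum>(k, l, m)\<in>S \<times> S \<times> S. c k * cnj (c l) * c m * of_real (triple_coeff \<sigma> k l m) * mode \<sigma> (k + m - l) z)"
proof -
  define E where "E w = exp (cnj w * z - of_real ((cmod w)\<^sup>2) / 2)" for w
  define T where "T = (\<lambda>(k, l, m). \<lambda>w. c k * cnj (c l) * c m * (E w * (mode \<sigma> k w * cnj (mode \<sigma> l w) * mode \<sigma> m w)))"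
  define I where "I = (\<lambda>(k, l, m). c k * cnj (c l) * c m * (of_real (pi * triple_coeff \<sigma> k l m) * exp (\<i> * of_real \<sigma> * of_int (k + m - l) * z + z\<^sup>2 / 2)))"
  have "E w * (of_real ((cmod (v w))\<^sup>2) * v w) = (\<Sum>t\<in>S \<times> S \<times> S. T t w)" for w
  proof -
    have cnj_v: "cnj (v w) = (\<Sum>n\<in>S. cnj (c n) * cnj (mode \<sigma> n w))" by (simp add: v)
    have "cnj (v w) * v w = (\<Sum>(l, m)\<in>S \<times> S. cnj (c l) * cnj (mode \<sigma> l w) * (c m * mode \<sigma> m w))"
      unfolding cnj_v unfolding v sum_product sum.cartesian_product ..
    then have "v w * (cnj (v w) * v w) = (\<Sum>(k, l, m)\<in>S \<times> S \<times> S.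
        c k * mode \<sigma> k w * (cnj (c l) * cnj (mode \<sigma> l w) * (c m * mode \<sigma> m w)))"
      by (simp add: v[of w] sum_product sum.cartesian_product split_beta)
    then have "E w * (v w * (cnj (v w) * v w)) = (\<Sum>t\<in>S \<times> S \<times> S. T t w)"
      unfolding T_def by (simp add: sum_distrib_left split_beta mult_ac)
    also have "v w * (cnj (v w) * v w) = of_real ((cmod (v w))\<^sup>2) * v w"
      unfolding complex_norm_square by (simp only: mult_ac)
    finally show ?thesis .
  qed
  moreover have "has_bochner_integral lborel (\<lambda>w. \<Sum>t\<in>S \<times> S \<times> S. T t w) (\<Sum>t\<in>S \<times> S \<times> S. I t)"
  proof (rule has_bochner_integral_sum)
    fix t show "has_bochner_integral lborel (T t) (I t)"
      unfolding T_def I_def E_def split_beta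
      by (intro has_bochner_integral_mult_right bargmann_integral_mode_triple)
  qed
  ultimately have "LLL_proj (\<lambda>w. of_real ((cmod (v w))\<^sup>2) * v w) z
     = 1 / of_real pi * exp (- of_real ((cmod z)\<^sup>2) / 2) * (\<Sum>t\<in>S \<times> S \<times> S. I t)"
    unfolding LLL_proj_def E_def[symmetric] by (simp add: has_bochner_integral_integral_eq)
  also have "\<dots> = (\<Sum>(k, l, m)\<in>S \<times> S \<times> S. c k * cnj (c l) * c m * of_real (triple_coeff \<sigma> k l m) * mode \<sigma> (k + m - l) z)"
    unfolding sum_distrib_left
  proof (rule sum.cong[OF refl], clarify)
    fix k l m
    have "mode \<sigma> (k + m - l) z = exp (- of_real ((cmod z)\<^sup>2) / 2) * exp (\<i> * of_real \<sigma> * of_int (k + m - l) * z + z\<^sup>2 / 2)"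
      unfolding mode_def exp_add[symmetric] by (simp add: algebra_simps)
    then show "1 / of_real pi * exp (- of_real ((cmod z)\<^sup>2) / 2) * I (k, l, m)
      = c k * cnj (c l) * c m * of_real (triple_coeff \<sigma> k l m) * mode \<sigma> (k + m - l) z"
      by (simp add: I_def)
  qed
  finally show ?thesis .
qed

text \<open>Once the support is not a single frequency, the frequency $2 n_1 - n_0$, with $n_0 < n_1$ the
  extreme ones, occurs exactly once in the cubic term and not at all in the linear term.\<close>

lemma stationary_mode_sum_is_single:
  fixes S :: "int set"
  assumes \<sigma>: "\<sigma> > 0" and S: "finite S" "S \<noteq> {}" and c: "\<And>n. n \<in> S \<Longrightarrow> c n \<noteq> 0"
    and eq: "\<And>z. (\<Sum>n\<in>S. c n * (a + \<i> * (cnj \<alpha> - \<alpha>) * z + of_real \<sigma> * of_int n * \<alpha>) * mode \<sigma> n z) =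
      (\<Sum>(k, l, m)\<in>S \<times> S \<times> S. c k * cnj (c l) * c m * of_real (triple_coeff \<sigma> k l m) * mode \<sigma> (k + m - l) z)"
  obtains k where "S = {k}" "cnj \<alpha> = \<alpha>"
    "a + of_real \<sigma> * of_int k * \<alpha> = of_real ((cmod (c k))\<^sup>2 * triple_coeff \<sigma> k k k)"
proof -
  define e where "e n z = exp (\<i> * of_real \<sigma> * of_int n * z)" for n :: int and z
  \<comment> \<open>On this line the exponentials are real and ordered by n as r grows.\<close>
  have e_real: "e n (- \<i> * of_real r / of_real \<sigma>) = exp (of_int n * of_real r)" for n r
  proof -
    have "\<i> * of_real \<sigma> * of_int n * (- \<i> * of_real r / of_real \<sigma>) = of_int n * of_real r"
      using \<sigma> by (simp add: complex_eq_iff)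
    then show ?thesis by (simp only: e_def)
  qed
  define L where "L n z = c n * (a + \<i> * (cnj \<alpha> - \<alpha>) * z + of_real \<sigma> * of_int n * \<alpha>)" for n z
  define b where "b = (\<lambda>(k, l, m). c k * cnj (c l) * c m * of_real (triple_coeff \<sigma> k l m))"
  define \<nu> where "\<nu> = (\<lambda>(k, l, m). k + m - l :: int)"
  have eq': "(\<Sum>n\<in>S. L n z * e n z) = (\<Sum>t\<in>S \<times> S \<times> S. b t * e (\<nu> t) z)" for z
  proof -
    have "(\<Sum>n\<in>S. L n z * e n z) * exp (z\<^sup>2 / 2 - of_real ((cmod z)\<^sup>2) / 2)
        = (\<Sum>t\<in>S \<times> S \<times> S. b t * e (\<nu> t) z) * exp (z\<^sup>2 / 2 - of_real ((cmod z)\<^sup>2) / 2)"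
      using eq[of z] unfolding sum_distrib_right mode_eq_exp_mult L_def e_def b_def \<nu>_def
      by (simp add: split_beta mult.assoc)
    then show ?thesis by simp
  qed
  have \<alpha>: "cnj \<alpha> = \<alpha>"
  proof (rule ccontr)
    assume "cnj \<alpha> \<noteq> \<alpha>"
    define p where "p = complex_of_real (2 * pi / \<sigma>)"
    have p: "p \<noteq> 0" using \<sigma> by (simp add: p_def)
    have e_per: "e n (z + p) = e n z" for n z
    proof -
      have "\<i> * of_real \<sigma> * of_int n * (z + p) = \<i> * of_real \<sigma> * of_int n * z + \<i> * (of_int n * (of_real pi * 2))"
        using \<sigma> by (simp add: p_def field_simps)
      then show ?thesis by (simp only: e_def exp_add exp_integer_2pi) simp
    qed
    \<comment> \<open>Subtracting the equation at z from the one at z + p removes all periodic terms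
      and leaves a nonzero multiple of this sum.\<close>
    have "(\<Sum>n\<in>S. c n * e n z) = 0" for z
    proof -
      have "(\<Sum>n\<in>S. L n (z + p) * e n z) = (\<Sum>n\<in>S. L n z * e n z)"
        using eq'[of "z + p"] eq'[of z] by (simp add: e_per)
      moreover have "L n (z + p) = L n z + (\<i> * (cnj \<alpha> - \<alpha>) * p) * c n" for n
        by (simp add: L_def algebra_simps)
      ultimately have "(\<i> * (cnj \<alpha> - \<alpha>) * p) * (\<Sum>n\<in>S. c n * e n z) = 0"
        by (simp add: distrib_right sum.distrib sum_distrib_left mult.assoc)
      then show ?thesis using p \<open>cnj \<alpha> \<noteq> \<alpha>\<close> by simp
    qed
    then have "(\<Sum>n\<in>S. c n * exp (of_int n * of_real r)) = 0" for r :: real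
      by (metis (no_types, lifting) e_real sum.cong)
    then have "c (Max S) = 0"
      using S by (intro top_coefficient_eq_0[of S "Max S" "\<lambda>n. n" c]) (auto simp: order.not_eq_order_implies_strict)
    then show False using c S by simp
  qed
  define n0 where "n0 = Min S"
  define n1 where "n1 = Max S"
  have n01: "n0 \<in> S" "n1 \<in> S" and bounds: "\<And>n. n \<in> S \<Longrightarrow> n0 \<le> n \<and> n \<le> n1"
    using S by (auto simp: n0_def n1_def)
  have "n0 = n1"
  proof (rule ccontr)
    assume "n0 \<noteq> n1"
    then have "n0 < n1" using bounds[OF n01(1)] by simp
    \<comment> \<open>A disjoint union indexes the linear terms, with sign reversed, and the cubic
      ones, so that the whole equation is one vanishing exponential sum.\<close>
    define J where "J = S <+> (S \<times> S \<times> S)"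
    define B where "B = case_sum (\<lambda>n. - L n 0) b"
    define \<mu> where "\<mu> = case_sum (\<lambda>n. n) \<nu>"
    define j0 :: "int + int \<times> int \<times> int" where "j0 = Inr (n1, n0, n1)"
    have "B j0 = 0"
    proof (rule top_coefficient_eq_0[of J j0 \<mu> B])
      show "finite J" "j0 \<in> J" using S n01 by (auto simp: J_def j0_def)
      show "\<mu> j < \<mu> j0" if "j \<in> J" "j \<noteq> j0" for j
      proof (cases j)
        case (Inl n)
        then have "n \<le> n1" using that bounds by (auto simp: J_def)
        then show ?thesis using Inl \<open>n0 < n1\<close> by (simp add: \<mu>_def \<nu>_def j0_def)
      next
        case (Inr t)
        obtain k l m where t: "t = (k, l, m)" by (cases t)
        then have "k \<le> n1" "n0 \<le> l" "m \<le> n1" "(k, l, m) \<noteq> (n1, n0, n1)"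
          using that bounds Inr by (auto simp: J_def j0_def)
        then show ?thesis using Inr t by (auto simp: \<mu>_def \<nu>_def j0_def)
      qed
      fix r :: real
      \<comment> \<open>Only for real \<open>\<alpha>\<close> are the linear coefficients constant,
        as the comparison of frequencies requires.\<close>
      have L0: "L n z = L n 0" for n z by (simp add: L_def \<alpha>)
      have "(\<Sum>n\<in>S. L n 0 * exp (of_int n * of_real r)) = (\<Sum>t\<in>S \<times> S \<times> S. b t * exp (of_int (\<nu> t) * of_real r))"
        using eq'[of "- \<i> * of_real r / of_real \<sigma>"] unfolding e_real L0[of _ "- \<i> * of_real r / of_real \<sigma>"] .
      then show "(\<Sum>j\<in>J. B j * exp (of_int (\<mu> j) * of_real r)) = 0"
        unfolding J_def using S by (simp add: sum.Plus B_def \<mu>_def sum_negf)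
    qed
    then show False using c n01 triple_coeff_nonzero by (simp add: B_def j0_def b_def)
  qed
  then have Sk: "S = {n1}" using bounds n01 by force
  have "c n1 * (a + of_real \<sigma> * of_int n1 * \<alpha>) * mode \<sigma> n1 0
      = c n1 * (of_real ((cmod (c n1))\<^sup>2) * of_real (triple_coeff \<sigma> n1 n1 n1)) * mode \<sigma> n1 0"
    using eq[of 0] unfolding Sk complex_norm_square by (simp add: \<alpha> mult_ac)
  then have "a + of_real \<sigma> * of_int n1 * \<alpha> = of_real ((cmod (c n1))\<^sup>2 * triple_coeff \<sigma> n1 n1 n1)"
    using c[OF n01(2)] by simp
  then show thesis using that[OF Sk \<alpha>] by blast
qed

section \<open>Stationary waves\<close>

lemma magnetic_translation_mode:
  "magnetic_translation \<alpha> (mode \<sigma> n) z =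
     mode \<sigma> n z * exp ((\<alpha> - cnj \<alpha>) * z + \<i> * of_real \<sigma> * of_int n * \<alpha> + (\<alpha>\<^sup>2 - \<alpha> * cnj \<alpha>) / 2)"
  unfolding magnetic_translation_def mode_def exp_add[symmetric] complex_norm_square
  by (rule arg_cong[of _ _ exp]) (simp add: power2_eq_square field_simps)

text \<open>Completing the square in Im z shows a Gaussian profile across the line Im z = - \<sigma>
  n / 2. The bound is uniform in z, so the growth condition holds with exponent 0.\<close>

lemma cmod_mode_le: "cmod (mode \<sigma> n z) \<le> exp ((\<sigma> * of_int n)\<^sup>2 / 4)"
proof -
  have "Re (\<i> * of_real \<sigma> * of_int n * z + z\<^sup>2 / 2 - of_real ((cmod z)\<^sup>2) / 2)
      = (\<sigma> * of_int n)\<^sup>2 / 4 - (Im z + \<sigma> * of_int n / 2)\<^sup>2"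
    unfolding cmod_power2 by (simp add: power2_eq_square field_simps)
  also have "\<dots> \<le> (\<sigma> * of_int n)\<^sup>2 / 4" by simp
  finally show ?thesis unfolding mode_def norm_exp_eq_Re by simp
qed

lemma mode_in_F_space:
  assumes "\<gamma> > 0"
  shows "(\<lambda>z. b * mode (2 * pi / \<gamma>) k z) \<in> F_space \<gamma>"
proof -
  let ?\<sigma> = "2 * pi / \<gamma>"
  have "b * mode ?\<sigma> k z = exp (- of_real ((cmod z)\<^sup>2) / 2) * (b * exp (\<i> * of_real ?\<sigma> * of_int k * z + z\<^sup>2 / 2))" for z
    unfolding mode_def mult.left_commute[of _ b] exp_add[symmetric] by simp
  moreover have "(\<lambda>z. b * exp (\<i> * of_real ?\<sigma> * of_int k * z + z\<^sup>2 / 2)) holomorphic_on UNIV"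
    by (intro holomorphic_intros) auto
  moreover have "cmod (b * mode ?\<sigma> k z) \<le> cmod b * exp ((?\<sigma> * of_int k)\<^sup>2 / 4) * japanese_bracket z powr 0" for z
  proof -
    have "japanese_bracket z \<noteq> 0"
      unfolding japanese_bracket_def by (smt (verit) real_sqrt_eq_0_iff zero_le_power2)
    then show ?thesis using cmod_mode_le[of ?\<sigma> k z] by (simp add: norm_mult mult_left_mono)
  qed
  ultimately have "(\<lambda>z. b * mode ?\<sigma> k z) \<in> LLL_space"
    unfolding LLL_space_def by blast
  moreover have "magnetic_translation (of_real \<gamma>) (\<lambda>z. b * mode ?\<sigma> k z) z = b * mode ?\<sigma> k z" for z
  proof -
    have "\<i> * complex_of_real ?\<sigma> * of_int k * of_real \<gamma> = \<i> * (of_int k * (of_real pi * 2))"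
      using assms by (simp add: field_simps)
    then have "magnetic_translation (of_real \<gamma>) (mode ?\<sigma> k) z = mode ?\<sigma> k z"
      by (simp add: magnetic_translation_mode power2_eq_square exp_integer_2pi)
    then show ?thesis by (simp add: magnetic_translation_def)
  qed
  ultimately show ?thesis by (auto simp: F_space_def)
qed

text \<open>The support \<open>S\<close> is nonempty because the zero function has infinitely many
  zeros modulo \<gamma>.\<close>

lemma G_space_imp_mode_sum:
  assumes \<gamma>: "\<gamma> > 0" and u: "u \<in> G_space \<gamma>"
  obtains S c where "finite S" "S \<noteq> {}" "\<And>n. n \<in> S \<Longrightarrow> c n \<noteq> 0"
    "\<And>z. u z = (\<Sum>n\<in>S. c n * mode (2 * pi / \<gamma>) n z)"
proof -
  define \<sigma> where "\<sigma> = 2 * pi / \<gamma>"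
  define c0 where "c0 = \<i> * complex_of_real \<sigma>"
  have c0: "c0 \<noteq> 0" "2 * of_real pi * \<i> / c0 = of_real \<gamma>"
    using \<gamma> by (auto simp: c0_def \<sigma>_def)
  \<comment> \<open>The mode of frequency 0. It is fixed by the magnetic translation by \<gamma>, so
    dividing by it turns magnetic periodicity into ordinary periodicity.\<close>
  define W where "W z = exp (z\<^sup>2 / 2 - complex_of_real ((cmod z)\<^sup>2) / 2)" for z
  have W_shift: "exp ((of_real \<gamma> * cnj z - cnj (of_real \<gamma>) * z) / 2) * W (z + of_real \<gamma>) = W z" for z
    unfolding W_def exp_add[symmetric] complex_norm_square
    by (rule arg_cong[of _ _ exp]) (simp add: power2_eq_square field_simps)
  obtain f where f: "f holomorphic_on UNIV" "\<And>z. u z = exp (- of_real ((cmod z)\<^sup>2) / 2) * f z"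
    using u by (auto simp: G_space_def F_space_def LLL_space_def)
  obtain M C where MC: "\<And>z. cmod (u z) \<le> C * japanese_bracket z powr M"
    using u by (auto simp: G_space_def F_space_def LLL_space_def)
  have trans: "magnetic_translation (of_real \<gamma>) u = u"
    and fin: "finite ({z. u z = 0} // period_rel \<gamma>)"
    using u by (auto simp: G_space_def F_space_def)
  define g where "g z = f z * exp (- z\<^sup>2 / 2)" for z
  have hol: "g holomorphic_on UNIV"
    unfolding g_def by (intro holomorphic_intros f) auto
  have ug: "u z = W z * g z" for z
  proof -
    have "W z * g z = W z * exp (- z\<^sup>2 / 2) * f z" by (simp add: g_def)
    also have "W z * exp (- z\<^sup>2 / 2) = exp (- of_real ((cmod z)\<^sup>2) / 2)"
      unfolding W_def exp_add[symmetric] by simp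
    finally show ?thesis by (simp add: f(2))
  qed
  have W_nz: "W z \<noteq> 0" for z by (simp add: W_def)
  have per: "g (z + of_real \<gamma>) = g z" for z
  proof -
    have "W z * g (z + of_real \<gamma>) = magnetic_translation (of_real \<gamma>) u z"
      unfolding magnetic_translation_def ug W_shift[of z, symmetric] by (simp only: mult.assoc)
    also have "\<dots> = W z * g z" by (simp add: trans ug)
    finally show ?thesis using W_nz by simp
  qed
  \<comment> \<open>The term |M|/2 comes from bounding the bracket by exp(|z|^2/2); the extra 1 pays
    for dividing by W, whose modulus is at least exp(-|z|^2).\<close>
  have growth: "cmod (g z) \<le> \<bar>C\<bar> * exp ((\<bar>M\<bar> / 2 + 1) * (cmod z)\<^sup>2)" for z
  proof -
    let ?x = "(cmod z)\<^sup>2"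
    have jb: "japanese_bracket z \<ge> 1" by (simp add: japanese_bracket_def)
    have "japanese_bracket z \<le> exp (?x / 2)"
    proof -
      have "1 + ?x \<le> (exp (?x / 2))\<^sup>2"
        using exp_ge_add_one_self[of ?x] by (simp flip: exp_double)
      then show ?thesis unfolding japanese_bracket_def by (intro real_le_lsqrt) auto
    qed
    then have "japanese_bracket z powr M \<le> exp (?x / 2) powr \<bar>M\<bar>"
      using jb powr_mono[of M "\<bar>M\<bar>" "japanese_bracket z"] powr_mono2[of "\<bar>M\<bar>" "japanese_bracket z" "exp (?x / 2)"]
      by linarith
    also have "\<dots> = exp (\<bar>M\<bar> / 2 * ?x)" by (simp add: powr_def)
    finally have "C * japanese_bracket z powr M \<le> \<bar>C\<bar> * exp (\<bar>M\<bar> / 2 * ?x)"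
      by (intro mult_mono) auto
    with MC[of z] have u_le: "cmod (u z) \<le> \<bar>C\<bar> * exp (\<bar>M\<bar> / 2 * ?x)" by linarith
    have "Re (z\<^sup>2 / 2 - of_real ?x / 2) = - (Im z)\<^sup>2"
      unfolding cmod_power2 by (simp add: power2_eq_square field_simps)
    also have "\<dots> \<ge> - ?x" unfolding cmod_power2 by simp
    finally have "exp (- ?x) \<le> cmod (W z)" unfolding W_def norm_exp_eq_Re by simp
    then have "exp (- ?x) * cmod (g z) \<le> cmod (u z)"
      by (simp add: ug norm_mult mult_right_mono)
    with u_le have "exp (- ?x) * cmod (g z) \<le> \<bar>C\<bar> * exp (\<bar>M\<bar> / 2 * ?x)" by linarith
    then have "exp ?x * (exp (- ?x) * cmod (g z)) \<le> exp ?x * (\<bar>C\<bar> * exp (\<bar>M\<bar> / 2 * ?x))"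
      by (intro mult_left_mono) auto
    moreover have "exp ((\<bar>M\<bar> / 2 + 1) * ?x) = exp ?x * exp (\<bar>M\<bar> / 2 * ?x)"
      unfolding exp_add[symmetric] by (simp add: algebra_simps)
    ultimately show ?thesis by (simp add: exp_minus mult_ac)
  qed
  have E_per: "exp (c0 * (z + of_int n * of_real \<gamma>)) = exp (c0 * z)" for z n
  proof -
    have "c0 * (z + of_int n * of_real \<gamma>) = c0 * z + \<i> * (of_int n * (of_real pi * 2))"
      using \<gamma> by (simp add: c0_def \<sigma>_def field_simps)
    then show ?thesis by (simp only: exp_add exp_integer_2pi) simp
  qed
  \<comment> \<open>The exponential is constant on each class modulo \<gamma>, so a class has a
    singleton image and \<open>the_elem\<close> reads off its value; finitely many classes give
    finitely many points.\<close>
  have finE: "finite ((\<lambda>z. exp (c0 * z)) ` {z. g z = 0})"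
  proof (rule finite_subset)
    show "finite ((\<lambda>X. the_elem ((\<lambda>z. exp (c0 * z)) ` X)) ` ({z. u z = 0} // period_rel \<gamma>))"
      using fin by simp
    show "(\<lambda>z. exp (c0 * z)) ` {z. g z = 0} \<subseteq>
        (\<lambda>X. the_elem ((\<lambda>z. exp (c0 * z)) ` X)) ` ({z. u z = 0} // period_rel \<gamma>)"
    proof
      fix w assume "w \<in> (\<lambda>z. exp (c0 * z)) ` {z. g z = 0}"
      then obtain z where z: "g z = 0" "w = exp (c0 * z)" by blast
      have "(\<lambda>z. exp (c0 * z)) ` (period_rel \<gamma> `` {z}) = {w}"
        using E_per[of z] z(2) by (force simp: period_rel_def intro: exI[of _ 0])
      moreover have "period_rel \<gamma> `` {z} \<in> {z. u z = 0} // period_rel \<gamma>"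
        using z(1) by (intro quotientI) (simp add: ug)
      ultimately show "w \<in> (\<lambda>X. the_elem ((\<lambda>z. exp (c0 * z)) ` X)) ` ({z. u z = 0} // period_rel \<gamma>)"
        by (intro image_eqI[of _ _ "period_rel \<gamma> `` {z}"]) auto
    qed
  qed
  obtain T a where T: "finite T" "\<And>z. g z = (\<Sum>n\<in>T. a n * exp (of_int n * c0 * z))"
    by (rule periodic_entire_finite_zeros_imp_trig_polynomial[OF hol c0(1) _ growth finE])
       (use per c0(2) that in auto)
  define S where "S = {n \<in> T. a n \<noteq> 0}"
  have gS: "g z = (\<Sum>n\<in>S. a n * exp (of_int n * c0 * z))" for z
    unfolding T(2) S_def using T(1) by (intro sum.mono_neutral_right) auto
  have "S \<noteq> {}"
  proof
    assume "S = {}"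
    then have "{z. g z = 0} = UNIV" by (simp add: gS)
    moreover have "- {0} \<subseteq> range (\<lambda>z. exp (c0 * z))"
    proof
      fix w :: complex assume "w \<in> - {0}"
      then have "w = exp (c0 * (Ln w / c0))" using c0(1) by simp
      then show "w \<in> range (\<lambda>z. exp (c0 * z))" by blast
    qed
    ultimately have "finite (- {0 :: complex})" using finE finite_subset by metis
    then show False by (simp add: finite_compl infinite_UNIV_char_0)
  qed
  moreover have "u z = (\<Sum>n\<in>S. a n * mode (2 * pi / \<gamma>) n z)" for z
    unfolding ug gS sum_distrib_left mode_eq_exp_mult W_def c0_def \<sigma>_def by (simp add: mult_ac)
  moreover have "finite S" using T(1) by (simp add: S_def)
  moreover have "\<And>n. n \<in> S \<Longrightarrow> a n \<noteq> 0" by (simp add: S_def)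
  ultimately show thesis using that[of S a] by blast
qed

section \<open>Normalisation constants and the explicit waves\<close>

definition psi_amp :: "real \<Rightarrow> int \<Rightarrow> real" where
  "psi_amp \<gamma> k = (2 / (pi * \<gamma>\<^sup>2)) powr (1/4) * exp (- pi\<^sup>2 * (of_int k)\<^sup>2 / \<gamma>\<^sup>2)"

lemma psi_amp_pos: "\<gamma> > 0 \<Longrightarrow> psi_amp \<gamma> k > 0"
  by (simp add: psi_amp_def)

lemma psi_eq_mode:
  "psi \<gamma> k z = of_real (psi_amp \<gamma> k) * mode (2 * pi / \<gamma>) k z"
proof -
  have "complex_of_real (exp (- pi\<^sup>2 * (of_int k)\<^sup>2 / \<gamma>\<^sup>2)) * mode (2 * pi / \<gamma>) k z
     = exp (- (of_real pi)\<^sup>2 * (of_int k)\<^sup>2 / (of_real \<gamma>)\<^sup>2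
          + 2 * \<i> * of_int k * of_real pi / of_real \<gamma> * z
          + z\<^sup>2 / 2 - of_real ((cmod z)\<^sup>2) / 2)"
    unfolding exp_of_real[symmetric] mode_def exp_add[symmetric]
    by (rule arg_cong[of _ _ exp]) (simp add: field_simps)
  then show ?thesis unfolding psi_def psi_amp_def of_real_mult mult.assoc by simp
qed

text \<open>The factors exp(-2 pi^2 k^2/\<gamma>^2) and exp(2 pi^2 k^2/\<gamma>^2) cancel. This is
  why the time frequency of the waves does not depend on k.\<close>

lemma psi_amp_triple_coeff:
  assumes "\<gamma> > 0"
  shows "(psi_amp \<gamma> k)\<^sup>2 * triple_coeff (2 * pi / \<gamma>) k k k = 1 / (\<gamma> * sqrt pi)"
proof -
  define x where "x = pi\<^sup>2 * (of_int k)\<^sup>2 / \<gamma>\<^sup>2"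
  have "((2 / (pi * \<gamma>\<^sup>2)) powr (1/4))\<^sup>2 = (2 / (pi * \<gamma>\<^sup>2)) powr (1/2)"
    using assms by (simp add: powr_power)
  also have "\<dots> = sqrt 2 / (sqrt pi * \<gamma>)"
    using assms by (simp add: powr_half_sqrt real_sqrt_divide real_sqrt_mult)
  finally have "(psi_amp \<gamma> k)\<^sup>2 = sqrt 2 / (sqrt pi * \<gamma>) * exp (- 2 * x)"
    by (simp add: psi_amp_def power_mult_distrib x_def flip: exp_double)
  moreover have "triple_coeff (2 * pi / \<gamma>) k k k = exp (2 * x) / sqrt 2"
    by (simp add: triple_coeff_def x_def power2_eq_square field_simps)
  ultimately show ?thesis by (simp add: exp_minus field_simps)
qed

text \<open>Since k + k - k = k, the cubic term maps a multiple of one mode to a multiple of the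
  same mode, and the equation reduces to an ordinary differential equation for the coefficient,
  whose modulus is conserved.\<close>

lemma LLL_solution_mode:
  "LLL_solution (\<lambda>t z. b * mode \<sigma> k z * exp (- \<i> * of_real ((cmod b)\<^sup>2 * triple_coeff \<sigma> k k k * t)))"
  unfolding LLL_solution_def
proof (intro allI)
  fix t z
  define \<omega> where "\<omega> = (cmod b)\<^sup>2 * triple_coeff \<sigma> k k k"
  let ?u = "\<lambda>t z. b * mode \<sigma> k z * exp (- \<i> * of_real (\<omega> * t))"
  \<comment> \<open>The derivative is taken in a complex time variable and then restricted to real
    times.\<close>
  have "((\<lambda>s. b * mode \<sigma> k z * exp (- \<i> * of_real \<omega> * s)) has_field_derivative - \<i> * of_real \<omega> * ?u t z) (at (of_real t))"
    by (auto intro!: derivative_eq_intros simp: mult.assoc)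
  from has_vector_derivative_real_field[OF this]
  have "((\<lambda>s. ?u s z) has_vector_derivative - \<i> * of_real \<omega> * ?u t z) (at t)"
    by (simp add: mult.assoc)
  moreover have "\<i> * (- \<i> * of_real \<omega> * ?u t z) = LLL_proj (\<lambda>w. of_real ((cmod (?u t w))\<^sup>2) * ?u t w) z"
  proof -
    let ?c = "b * exp (- \<i> * of_real (\<omega> * t))"
    have "LLL_proj (\<lambda>w. of_real ((cmod (?u t w))\<^sup>2) * ?u t w) z
       = ?c * cnj ?c * ?c * of_real (triple_coeff \<sigma> k k k) * mode \<sigma> k z"
      by (subst LLL_proj_cubic[where S = "{k}" and c = "\<lambda>_. ?c" and \<sigma> = \<sigma>]) auto
    also have "?c * cnj ?c = of_real ((cmod ?c)\<^sup>2)" by (rule complex_norm_square[symmetric])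
    also have "cmod ?c = cmod b" by (simp add: norm_mult)
    finally show ?thesis by (simp add: \<omega>_def mult_ac)
  qed
  ultimately show "\<exists>D. ((\<lambda>s. b * mode \<sigma> k z * exp (- \<i> * of_real ((cmod b)\<^sup>2 * triple_coeff \<sigma> k k k * s))) has_vector_derivative D) (at t) \<and>
      \<i> * D = LLL_proj (\<lambda>w. of_real ((cmod (b * mode \<sigma> k w * exp (- \<i> * of_real ((cmod b)\<^sup>2 * triple_coeff \<sigma> k k k * t))))\<^sup>2) *
         (b * mode \<sigma> k w * exp (- \<i> * of_real ((cmod b)\<^sup>2 * triple_coeff \<sigma> k k k * t)))) z"
    unfolding \<omega>_def by blast
qed

lemma psi_wave_eq_mode_wave:
  fixes \<kappa> :: complex and k :: int
  assumes "\<gamma> > 0"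
  defines "b \<equiv> \<kappa> * of_real (psi_amp \<gamma> k)"
  shows "\<kappa> * psi \<gamma> k z * exp (- \<i> * of_real ((cmod \<kappa>)\<^sup>2 * t / (\<gamma> * sqrt pi)))
    = b * mode (2 * pi / \<gamma>) k z * exp (- \<i> * of_real ((cmod b)\<^sup>2 * triple_coeff (2 * pi / \<gamma>) k k k * t))"
proof -
  have "(cmod b)\<^sup>2 * triple_coeff (2 * pi / \<gamma>) k k k * t = (cmod \<kappa>)\<^sup>2 * ((psi_amp \<gamma> k)\<^sup>2 * triple_coeff (2 * pi / \<gamma>) k k k) * t"
    by (simp add: b_def norm_mult power_mult_distrib)
  also have "\<dots> = (cmod \<kappa>)\<^sup>2 * t / (\<gamma> * sqrt pi)"
    unfolding psi_amp_triple_coeff[OF assms(1)] by simp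
  finally show ?thesis by (simp add: psi_eq_mode b_def)
qed

lemma M_stationary_wave_psi:
  assumes "\<gamma> > 0"
  shows "M_stationary_wave \<gamma> (\<lambda>t z. \<kappa> * psi \<gamma> k z * exp (- \<i> * of_real ((cmod \<kappa>)\<^sup>2 * t / (\<gamma> * sqrt pi))))"
  unfolding M_stationary_wave_def
proof (intro conjI)
  show "LLL_solution (\<lambda>t z. \<kappa> * psi \<gamma> k z * exp (- \<i> * of_real ((cmod \<kappa>)\<^sup>2 * t / (\<gamma> * sqrt pi))))"
    unfolding psi_wave_eq_mode_wave[OF assms] by (rule LLL_solution_mode)
  have "(\<lambda>z. \<kappa> * psi \<gamma> k z) \<in> F_space \<gamma>"
    using mode_in_F_space[OF assms, of "\<kappa> * of_real (psi_amp \<gamma> k)" k] by (simp add: psi_eq_mode mult.assoc)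
  then show "\<exists>a. \<exists>u0\<in>F_space \<gamma>. \<forall>t z. \<kappa> * psi \<gamma> k z * exp (- \<i> * of_real ((cmod \<kappa>)\<^sup>2 * t / (\<gamma> * sqrt pi)))
      = exp (- \<i> * of_real (a * t)) * u0 z"
    by (intro exI[of _ "(cmod \<kappa>)\<^sup>2 / (\<gamma> * sqrt pi)"] bexI[of _ "\<lambda>z. \<kappa> * psi \<gamma> k z"]) auto
qed

text \<open>These profiles have no zeros at all.\<close>

lemma psi_in_G_space:
  assumes "\<gamma> > 0" "\<kappa> \<noteq> 0"
  shows "(\<lambda>z. \<kappa> * psi \<gamma> k z) \<in> G_space \<gamma>"
proof -
  have "(\<lambda>z. \<kappa> * psi \<gamma> k z) \<in> F_space \<gamma>"
    using mode_in_F_space[OF assms(1), of "\<kappa> * of_real (psi_amp \<gamma> k)" k] by (simp add: psi_eq_mode mult.assoc)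
  moreover have "{z. \<kappa> * psi \<gamma> k z = 0} = {}"
    using assms psi_amp_pos[OF assms(1), of k] by (simp add: psi_eq_mode)
  ultimately show ?thesis by (simp add: G_space_def quotient_def)
qed

section \<open>Classification of the waves\<close>

lemma magnetic_translation_0 [simp]: "magnetic_translation 0 u = u"
  by (rule ext) (simp add: magnetic_translation_def)

lemma M_stationary_imp_MQ_stationary:
  assumes "M_stationary_wave \<gamma> u"
  shows "MQ_stationary_wave \<gamma> u"
proof -
  obtain a u0 where *: "LLL_solution u" "u0 \<in> F_space \<gamma>" "\<forall>t z. u t z = exp (- \<i> * of_real (a * t)) * u0 z"
    using assms unfolding M_stationary_wave_def by blast
  then have "\<forall>t z. u t z = exp (- \<i> * of_real (a * t)) * magnetic_translation (- 0 * of_real t) u0 z"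
    by simp
  with * show ?thesis unfolding MQ_stationary_wave_def by blast
qed

text \<open>The equation is used at time 0 only. It leaves a single mode and one relation between a
  and the now real \<open>\<alpha>\<close>; the form of the wave then determines u at all
  times.\<close>

lemma MQ_stationary_wave_in_G_space_imp_psi:
  assumes \<gamma>: "\<gamma> > 0" and wave: "MQ_stationary_wave \<gamma> u" and G: "u 0 \<in> G_space \<gamma>"
  shows "\<exists>(k::int) (\<kappa>::complex). u = (\<lambda>t z. \<kappa> * psi \<gamma> k z *
    exp (- \<i> * of_real ((cmod \<kappa>)\<^sup>2 * t / (\<gamma> * sqrt pi))))"
proof -
  define \<sigma> where "\<sigma> = 2 * pi / \<gamma>"
  have \<sigma>: "\<sigma> > 0" using \<gamma> by (simp add: \<sigma>_def)
  obtain a \<alpha> u0 where sol: "LLL_solution u"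
    and ueq: "\<And>t z. u t z = exp (- \<i> * of_real (a * t)) * magnetic_translation (- \<alpha> * of_real t) u0 z"
    using wave unfolding MQ_stationary_wave_def by blast
  have u0: "u 0 = u0" by (rule ext) (simp add: ueq)
  obtain S c where S: "finite S" "S \<noteq> {}" "\<And>n. n \<in> S \<Longrightarrow> c n \<noteq> 0"
    and u0_sum: "\<And>z. u0 z = (\<Sum>n\<in>S. c n * mode \<sigma> n z)"
    using G_space_imp_mode_sum[OF \<gamma> G] unfolding u0 \<sigma>_def by blast
  \<comment> \<open>Each mode evolves by the exponential of a polynomial in t, with linear
    coefficient \<open>\<beta>\<close> and quadratic coefficient \<open>\<delta>\<close>. The latter
    does not affect the derivative at 0 and vanishes once \<open>\<alpha>\<close> is real.\<close>
  define \<beta> where "\<beta> n z = - \<i> * of_real a + (cnj \<alpha> - \<alpha>) * z - \<i> * of_real \<sigma> * of_int n * \<alpha>" for n z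
  define \<delta> where "\<delta> = (\<alpha>\<^sup>2 - \<alpha> * cnj \<alpha>) / 2"
  have u_sum: "u t z = (\<Sum>n\<in>S. c n * mode \<sigma> n z * exp (of_real t * \<beta> n z + (of_real t)\<^sup>2 * \<delta>))" for t z
  proof -
    have translation_sum: "magnetic_translation (- \<alpha> * of_real t) u0 z = (\<Sum>n\<in>S. c n * magnetic_translation (- \<alpha> * of_real t) (mode \<sigma> n) z)"
      unfolding magnetic_translation_def u0_sum sum_distrib_left
      by (rule sum.cong) (simp_all only: mult_ac)
    have summand: "exp (- \<i> * of_real (a * t)) * (c n * magnetic_translation (- \<alpha> * of_real t) (mode \<sigma> n) z)
        = c n * mode \<sigma> n z * exp (of_real t * \<beta> n z + (of_real t)\<^sup>2 * \<delta>)" for n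
    proof -
      have exponent: "- \<i> * of_real (a * t) + ((- \<alpha> * of_real t - cnj (- \<alpha> * of_real t)) * z + \<i> * of_real \<sigma> * of_int n * (- \<alpha> * of_real t)
          + ((- \<alpha> * of_real t)\<^sup>2 - (- \<alpha> * of_real t) * cnj (- \<alpha> * of_real t)) / 2) = of_real t * \<beta> n z + (of_real t)\<^sup>2 * \<delta>"
        by (simp add: \<beta>_def \<delta>_def power2_eq_square field_simps)
      show ?thesis
        unfolding magnetic_translation_mode exponent[symmetric] exp_add[of "- \<i> * of_real (a * t)"]
        by (simp only: mult_ac)
    qed
    show ?thesis unfolding ueq translation_sum sum_distrib_left summand ..
  qed
  have "(\<Sum>n\<in>S. c n * (of_real a + \<i> * (cnj \<alpha> - \<alpha>) * z + of_real \<sigma> * of_int n * \<alpha>) * mode \<sigma> n z) =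
      (\<Sum>(k, l, m)\<in>S \<times> S \<times> S. c k * cnj (c l) * c m * of_real (triple_coeff \<sigma> k l m) * mode \<sigma> (k + m - l) z)" for z
  proof -
    obtain D where D: "((\<lambda>s. u s z) has_vector_derivative D) (at 0)"
      "\<i> * D = LLL_proj (\<lambda>w. of_real ((cmod (u 0 w))\<^sup>2) * u 0 w) z"
      using sol unfolding LLL_solution_def by blast
    have "((\<lambda>s. \<Sum>n\<in>S. c n * mode \<sigma> n z * exp (s * \<beta> n z + s\<^sup>2 * \<delta>)) has_field_derivative
        (\<Sum>n\<in>S. c n * mode \<sigma> n z * \<beta> n z)) (at (of_real 0))"
      by (auto intro!: derivative_eq_intros sum.cong)
    from has_vector_derivative_real_field[OF this]
    have "((\<lambda>s. u s z) has_vector_derivative (\<Sum>n\<in>S. c n * mode \<sigma> n z * \<beta> n z)) (at 0)"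
      unfolding u_sum .
    with D(1) have "D = (\<Sum>n\<in>S. c n * mode \<sigma> n z * \<beta> n z)" by (rule vector_derivative_unique_at)
    moreover have i\<beta>: "\<i> * \<beta> n z = of_real a + \<i> * (cnj \<alpha> - \<alpha>) * z + of_real \<sigma> * of_int n * \<alpha>" for n
      by (simp add: \<beta>_def algebra_simps)
    ultimately have "\<i> * D = (\<Sum>n\<in>S. c n * (of_real a + \<i> * (cnj \<alpha> - \<alpha>) * z + of_real \<sigma> * of_int n * \<alpha>) * mode \<sigma> n z)"
      unfolding i\<beta>[symmetric] by (simp add: sum_distrib_left mult_ac)
    then show ?thesis
      using D(2) LLL_proj_cubic[OF u0_sum, of z] unfolding u0 by simp
  qed
  from stationary_mode_sum_is_single[OF \<sigma> S this] obtain k where k: "S = {k}" "cnj \<alpha> = \<alpha>"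
    "of_real a + of_real \<sigma> * of_int k * \<alpha> = of_real ((cmod (c k))\<^sup>2 * triple_coeff \<sigma> k k k)"
    by blast
  have u_mode: "u t z = c k * mode \<sigma> k z * exp (- \<i> * of_real ((cmod (c k))\<^sup>2 * triple_coeff \<sigma> k k k * t))" for t z
  proof -
    \<comment> \<open>The relation fixes a + \<sigma> k \<alpha> but not a and \<alpha> separately;
      the wave depends on this sum alone.\<close>
    have "\<beta> k z = - \<i> * (of_real a + of_real \<sigma> * of_int k * \<alpha>)" by (simp add: \<beta>_def k(2) algebra_simps)
    also note k(3)
    finally have "of_real t * \<beta> k z = - \<i> * of_real ((cmod (c k))\<^sup>2 * triple_coeff \<sigma> k k k * t)" by simp
    moreover have "\<delta> = 0" by (simp add: \<delta>_def k(2) power2_eq_square)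
    ultimately show ?thesis by (simp add: u_sum k(1))
  qed
  define \<kappa> where "\<kappa> = c k / of_real (psi_amp \<gamma> k)"
  have "c k = \<kappa> * of_real (psi_amp \<gamma> k)" using psi_amp_pos[OF \<gamma>, of k] by (simp add: \<kappa>_def)
  then have "u = (\<lambda>t z. \<kappa> * psi \<gamma> k z * exp (- \<i> * of_real ((cmod \<kappa>)\<^sup>2 * t / (\<gamma> * sqrt pi))))"
    unfolding psi_wave_eq_mode_wave[OF \<gamma>] u_mode[abs_def] \<sigma>_def by (intro ext) (simp only: u_mode \<sigma>_def)
  then show ?thesis by blast
qed

theorem proposition3p12:
  fixes \<gamma> :: real
  assumes "\<gamma> > 0"
  shows
    "(\<forall>(k::int) (\<kappa>::complex).
        M_stationary_wave \<gamma> (\<lambda>t z. \<kappa> * psi \<gamma> k z *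
          exp (- \<i> * of_real ((cmod \<kappa>)\<^sup>2 * t / (\<gamma> * sqrt pi))))) \<and>
     (\<forall>(k::int) (\<kappa>::complex). \<kappa> \<noteq> 0 \<longrightarrow> (\<lambda>z. \<kappa> * psi \<gamma> k z) \<in> G_space \<gamma>) \<and>
     (\<forall>u. M_stationary_wave \<gamma> u \<and> u 0 \<in> G_space \<gamma> \<longrightarrow>
        (\<exists>(k::int) (\<kappa>::complex). u = (\<lambda>t z. \<kappa> * psi \<gamma> k z *
          exp (- \<i> * of_real ((cmod \<kappa>)\<^sup>2 * t / (\<gamma> * sqrt pi)))))) \<and>
     (\<forall>u. MQ_stationary_wave \<gamma> u \<and> u 0 \<in> G_space \<gamma> \<longrightarrow>
        (\<exists>(k::int) (\<kappa>::complex). u = (\<lambda>t z. \<kappa> * psi \<gamma> k z *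
          exp (- \<i> * of_real ((cmod \<kappa>)\<^sup>2 * t / (\<gamma> * sqrt pi))))))"
proof (intro conjI allI impI)
  fix u assume "M_stationary_wave \<gamma> u \<and> u 0 \<in> G_space \<gamma>"
  then have "MQ_stationary_wave \<gamma> u" "u 0 \<in> G_space \<gamma>"
    using M_stationary_imp_MQ_stationary by auto
  then show "\<exists>(k::int) (\<kappa>::complex). u = (\<lambda>t z. \<kappa> * psi \<gamma> k z *
      exp (- \<i> * of_real ((cmod \<kappa>)\<^sup>2 * t / (\<gamma> * sqrt pi))))"
    by (rule MQ_stationary_wave_in_G_space_imp_psi[OF assms])
next
  fix u assume "MQ_stationary_wave \<gamma> u \<and> u 0 \<in> G_space \<gamma>"
  then have "MQ_stationary_wave \<gamma> u" "u 0 \<in> G_space \<gamma>" by auto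
  then show "\<exists>(k::int) (\<kappa>::complex). u = (\<lambda>t z. \<kappa> * psi \<gamma> k z *
      exp (- \<i> * of_real ((cmod \<kappa>)\<^sup>2 * t / (\<gamma> * sqrt pi))))"
    by (rule MQ_stationary_wave_in_G_space_imp_psi[OF assms])
next
  fix k \<kappa>
  show "M_stationary_wave \<gamma> (\<lambda>t z. \<kappa> * psi \<gamma> k z *
      exp (- \<i> * of_real ((cmod \<kappa>)\<^sup>2 * t / (\<gamma> * sqrt pi))))"
    by (rule M_stationary_wave_psi[OF assms])
  show "(\<lambda>z. \<kappa> * psi \<gamma> k z) \<in> G_space \<gamma>" if "\<kappa> \<noteq> 0"
    by (rule psi_in_G_space[OF assms that])
qed

end
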